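(* $\mathcal I_{P_1}(\mathcal K)=\mathcal I_{HS}(\mathcal K)\cdot\mathcal I_{diag}(\mathcal K)$, i.e. the elements of $\mathcal I_{P_1}(\mathcal K)$ are exactly the products $UW$ with $U\in\mathcal I_{HS}(\mathcal K)$ and $W\in\mathcal I_{diag}(\mathcal K)$. The orbits in $\mathcal I_{P_1}(\mathcal K)$ of the group $\mathcal I^0_{P_1}(\mathcal K)$ with respect to left multiplication are precisely the sets $\mathcal I^{2m}_{P_1}(\mathcal K)$, $m\in\mathbb N\cup\{\infty\}$.
   Context: Let $\mathcal K$ be an infinite-dimensional separable complex Hilbert space with a complex conjugation $f\mapsto f^*$ (an antiunitary involution); for bounded $A$ put $\overline{A}f=(A(f^* ))^*$. Fix a basis projection $P_1$, i.e. an orthogonal projection with $P_1+\overline{P_1}=\mathbf 1$; put $P_2=\mathbf 1-P_1$ and $A_{mn}=P_mAP_n$. Let $\mathcal I(\mathcal K)=\{V\in\mathfrak B(\mathcal K):V^*V=\mathbf 1,\ \overline V=V\}$, $\mathcal I_{P_1}(\mathcal K)=\{V\in\mathcal I(\mathcal K):V_{12}\text{ is Hilbert–Schmidt}\}$, $\mathcal I_{HS}(\mathcal K)=\{U\in\mathcal I(\mathcal K):U-\mathbf 1\text{ is Hilbert–Schmidt}\}$, $\mathcal I_{diag}(\mathcal K)=\{W\in\mathcal I(\mathcal K):[P_1,W]=0\}$, and $\mathcal I^{2m}_{P_1}(\mathcal K)=\{V\in\mathcal I_{P_1}(\mathcal K):-\tfrac12\operatorname{ind}V=m\}$, where $-\operatorname{ind}V=\dim\ker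 V^*$ (which is even or infinite for $V\in\mathcal I_{P_1}(\mathcal K)$). $\mathbb N$ contains $0$. $\mathcal I^0_{P_1}(\mathcal K)$ is the group of unitary elements of $\mathcal I_{P_1}(\mathcal K)$. *)

theory Defs
  imports "HOL-Analysis.Analysis" "HOL-Library.Extended_Nat"
begin

section \<open>Complex Hilbert spaces\<close>

text \<open>
  The norm and topology are those of the underlying real Hilbert space, whose inner product is
  the real part of the complex one; so positivity, definiteness and
  \<open>norm x = sqrt (Re (cinner x x))\<close> are inherited from \<^class>\<open>real_inner\<close>.
  \<open>cinner\<close> is antilinear in the first argument.
\<close>

class complex_hilbert = real_inner + complete_space +
  fixes scaleC :: "complex \<Rightarrow> 'a \<Rightarrow> 'a"  (infixr \<open>*\<^sub>C\<close> 75)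
    and cinner :: "'a \<Rightarrow> 'a \<Rightarrow> complex"
  assumes scaleC_add_right: "c *\<^sub>C (x + y) = c *\<^sub>C x + c *\<^sub>C y"
    and scaleC_add_left: "(c + d) *\<^sub>C x = c *\<^sub>C x + d *\<^sub>C x"
    and scaleC_scaleC: "c *\<^sub>C d *\<^sub>C x = (c * d) *\<^sub>C x"
    and scaleC_of_real: "complex_of_real r *\<^sub>C x = r *\<^sub>R x"
    and cinner_commute: "cinner x y = cnj (cinner y x)"
    and cinner_add_right: "cinner x (y + z) = cinner x y + cinner x z"
    and cinner_scaleC_right: "cinner x (c *\<^sub>C y) = c * cinner x y"
    and inner_eq_Re_cinner: "inner x y = Re (cinner x y)"

global_interpretation complex_vector: vector_space "scaleC :: complex \<Rightarrow> 'a \<Rightarrow> 'a::complex_hilbert"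
proof unfold_locales
  show "1 *\<^sub>C x = x" for x :: 'a
    using scaleC_of_real[of 1 x] by simp
qed (rule scaleC_add_right scaleC_add_left scaleC_scaleC)+

text \<open>
  Complex dimension with a single infinite value. In a separable Hilbert space this agrees with the
  Hilbert dimension of closed subspaces, \<open>\<infinity>\<close> standing for the countably infinite cardinal.
\<close>

definition cdimension :: "'a::complex_hilbert set \<Rightarrow> enat" where
  "cdimension S = (if \<exists>B. finite B \<and> S \<subseteq> complex_vector.span B
                   then enat (complex_vector.dim S) else \<infinity>)"

definition orthonormal_basis :: "'a::complex_hilbert set \<Rightarrow> bool" where
  "orthonormal_basis E \<longleftrightarrow>
     (\<forall>e\<in>E. \<forall>f\<in>E. cinner e f = (if e = f then 1 else 0)) \<and>
     closure (complex_vector.span E) = UNIV"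

section \<open>Bounded operators\<close>

definition bounded_clinear :: "('a::complex_hilbert \<Rightarrow> 'a) \<Rightarrow> bool" where
  "bounded_clinear A \<longleftrightarrow> bounded_linear A \<and> (\<forall>c x. A (c *\<^sub>C x) = c *\<^sub>C A x)"

definition cadjoint :: "('a::complex_hilbert \<Rightarrow> 'a) \<Rightarrow> 'a \<Rightarrow> 'a" where
  "cadjoint A = (THE B. \<forall>x y. cinner (A x) y = cinner x (B y))"

definition hilbert_schmidt :: "('a::complex_hilbert \<Rightarrow> 'a) \<Rightarrow> bool" where
  "hilbert_schmidt A \<longleftrightarrow> bounded_clinear A \<and>
     (\<exists>E. orthonormal_basis E \<and> (\<lambda>e. (norm (A e))\<^sup>2) summable_on E)"

definition orthogonal_projection :: "('a::complex_hilbert \<Rightarrow> 'a) \<Rightarrow> bool" where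
  "orthogonal_projection P \<longleftrightarrow> bounded_clinear P \<and> P \<circ> P = P \<and> cadjoint P = P"

section \<open>Conjugations and basis projections\<close>

definition conjugation :: "('a::complex_hilbert \<Rightarrow> 'a) \<Rightarrow> bool" where
  "conjugation J \<longleftrightarrow>
     (\<forall>x y. J (x + y) = J x + J y) \<and> (\<forall>c x. J (c *\<^sub>C x) = cnj c *\<^sub>C J x) \<and>
     (\<forall>x y. cinner (J x) (J y) = cinner y x) \<and> (\<forall>x. J (J x) = x)"

definition conj_op :: "('a::complex_hilbert \<Rightarrow> 'a) \<Rightarrow> ('a \<Rightarrow> 'a) \<Rightarrow> 'a \<Rightarrow> 'a" where
  "conj_op J A = (\<lambda>f. J (A (J f)))"

definition basis_projection :: "('a::complex_hilbert \<Rightarrow> 'a) \<Rightarrow> ('a \<Rightarrow> 'a) \<Rightarrow> bool" where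
  "basis_projection J P \<longleftrightarrow> orthogonal_projection P \<and> (\<forall>f. P f + conj_op J P f = f)"

section \<open>Semigroups of isometries\<close>

definition isom :: "('a::complex_hilbert \<Rightarrow> 'a) \<Rightarrow> ('a \<Rightarrow> 'a) set" where
  "isom J = {V. bounded_clinear V \<and> cadjoint V \<circ> V = id \<and> conj_op J V = V}"

text \<open>The Hilbert--Schmidt operator below is \<open>V\<^sub>1\<^sub>2 = P\<^sub>1 V P\<^sub>2\<close> with \<open>P\<^sub>2 = 1 - P\<^sub>1\<close>.\<close>

definition isom_P :: "('a::complex_hilbert \<Rightarrow> 'a) \<Rightarrow> ('a \<Rightarrow> 'a) \<Rightarrow> ('a \<Rightarrow> 'a) set" where
  "isom_P J P1 = {V \<in> isom J. hilbert_schmidt (P1 \<circ> V \<circ> (\<lambda>f. f - P1 f))}"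

definition isom_HS :: "('a::complex_hilbert \<Rightarrow> 'a) \<Rightarrow> ('a \<Rightarrow> 'a) set" where
  "isom_HS J = {U \<in> isom J. hilbert_schmidt (\<lambda>f. U f - f)}"

definition isom_diag :: "('a::complex_hilbert \<Rightarrow> 'a) \<Rightarrow> ('a \<Rightarrow> 'a) \<Rightarrow> ('a \<Rightarrow> 'a) set" where
  "isom_diag J P1 = {W \<in> isom J. P1 \<circ> W = W \<circ> P1}"

definition isom_P_unitary :: "('a::complex_hilbert \<Rightarrow> 'a) \<Rightarrow> ('a \<Rightarrow> 'a) \<Rightarrow> ('a \<Rightarrow> 'a) set" where
  "isom_P_unitary J P1 = {U \<in> isom_P J P1. U \<circ> cadjoint U = id}"

text \<open>\<open>- ind V = dim ker V\<^sup>*\<close> for an isometry \<open>V\<close>.\<close>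

definition neg_ind :: "('a::complex_hilbert \<Rightarrow> 'a) \<Rightarrow> enat" where
  "neg_ind V = cdimension {f. cadjoint V f = 0}"

text \<open>
  The condition \<open>- 1/2 ind V = m\<close> is stated as \<open>- ind V = 2 * m\<close>, where \<open>2 * \<infinity> = \<infinity>\<close>.
\<close>

definition isom_P_ind :: "('a::complex_hilbert \<Rightarrow> 'a) \<Rightarrow> ('a \<Rightarrow> 'a) \<Rightarrow> enat \<Rightarrow> ('a \<Rightarrow> 'a) set" where
  "isom_P_ind J P1 m = {V \<in> isom_P J P1. neg_ind V = 2 * m}"

definition left_orbit :: "('a \<Rightarrow> 'a) set \<Rightarrow> ('a \<Rightarrow> 'a) \<Rightarrow> ('a \<Rightarrow> 'a) set" where
  "left_orbit G V = {U \<circ> V | U. U \<in> G}"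

end

theory Submission
  imports Defs
begin

text \<open>
  Write \<open>P\<^sub>2 = 1 - P\<^sub>1 = J P\<^sub>1 J\<close>.  That products \<open>U W\<close> lie in \<open>isom_P\<close> follows from the ideal property of
  Hilbert--Schmidt operators.  To factor an element \<open>V\<close> of \<open>isom_P\<close>, it suffices to
  find a diagonal isometry \<open>W\<close> with \<open>V - W\<close> Hilbert--Schmidt
  (\<open>isom_P_near_isom_diag\<close>) and then a real unitary \<open>U\<close> with \<open>U - 1\<close> Hilbert--Schmidt that carries \<open>W\<close> to
  \<open>V\<close> (\<open>hilbert_schmidt_intertwiner\<close>).

  Both operators are polar parts of explicit operators \<open>X\<close>: of \<open>V\<^sub>1\<^sub>1\<close> on the range of \<open>P\<^sub>1\<close>, extended to
  the range of \<open>P\<^sub>2\<close> by conjugation with \<open>J\<close>, and of \<open>V W\<^sup>* + (1 - V V\<^sup>*) (1 - W W\<^sup>*)\<close>.  In both cases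
  \<open>1 - X\<^sup>* X\<close> is a self-adjoint Hilbert--Schmidt operator, so it has an orthonormal eigenbasis
  (\<open>eigenbasis_exists\<close>, \<open>real_eigenbasis_exists\<close>); the images \<open>X b\<close> are pairwise orthogonal with norms
  close to \<open>1\<close>, and normalizing them gives an isometry at Hilbert--Schmidt distance from \<open>X\<close>.  The basis
  vectors in the kernel of \<open>X\<close> need images orthogonal to the range of \<open>X\<close>.  For \<open>V\<^sub>1\<^sub>1\<close> these are the
  vectors \<open>V (J b)\<close>.  For the second operator, the kernels of \<open>X\<close> and \<open>X\<^sup>*\<close> are interchanged when \<open>V\<close> and
  \<open>W\<close> are, and an injection between their bases exists in one of the two directions.  The isometry so
  obtained carries \<open>W\<close> to \<open>V\<close> or \<open>V\<close> to \<open>W\<close>, and it is invertible because an isometry \<open>U\<close> with \<open>U - 1\<close>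
  Hilbert--Schmidt is unitary (\<open>hilbert_schmidt_perturbation_surj\<close>).

  Since \<open>U\<close> is unitary, \<open>V\<close> and \<open>W\<close> have the same index, and the cokernel of the diagonal \<open>W\<close> is the
  orthogonal sum of its part in the range of \<open>P\<^sub>1\<close> and the conjugate of that part; hence the index is
  even or infinite (\<open>neg_ind_diag\<close>).  Two diagonal isometries of equal index differ by a diagonal unitary
  (\<open>diag_intertwiner\<close>), because infinite orthonormal sets in a separable space are all countable; so two
  elements of \<open>isom_P\<close> of equal index lie in one orbit.  Every index occurs, by shifts of an orthonormal
  basis of the range of \<open>P\<^sub>1\<close> (\<open>diag_isometry_exists\<close>).
\<close>


section \<open>Complex inner products\<close>

lemma cinner_add_left: "cinner (x + y) z = cinner x z + cinner (y :: 'a::complex_hilbert) z"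
  by (metis cinner_commute cinner_add_right complex_cnj_add)

lemma cinner_scaleC_left: "cinner (c *\<^sub>C x) y = cnj c * cinner (x :: 'a::complex_hilbert) y"
  by (metis cinner_commute cinner_scaleC_right complex_cnj_mult)

lemma cmod_cinner_commute: "cmod (cinner x y) = cmod (cinner y (x :: 'a::complex_hilbert))"
  by (subst cinner_commute) simp

lemma scaleC_minus1: "(-1) *\<^sub>C x = - (x :: 'a::complex_hilbert)"
  using scaleC_of_real[of "-1" x] by simp

lemma cinner_minus_right: "cinner x (- y) = - cinner x (y :: 'a::complex_hilbert)"
  using cinner_scaleC_right[of x "-1" y] by (simp add: scaleC_minus1)

lemma cinner_minus_left: "cinner (- x) y = - cinner x (y :: 'a::complex_hilbert)"
  using cinner_scaleC_left[of "-1" x y] by (simp add: scaleC_minus1)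

lemma cinner_diff_right: "cinner x (y - z) = cinner x y - cinner x (z :: 'a::complex_hilbert)"
  using cinner_add_right[of x y "- z"] by (simp add: cinner_minus_right)

lemma cinner_diff_left: "cinner (x - y) z = cinner x z - cinner (y :: 'a::complex_hilbert) z"
  using cinner_add_left[of x "- y" z] by (simp add: cinner_minus_left)

lemma cinner_zero_right [simp]: "cinner x (0 :: 'a::complex_hilbert) = 0"
  using cinner_diff_right[of x 0 0] by simp

lemma cinner_zero_left [simp]: "cinner (0 :: 'a::complex_hilbert) x = 0"
  using cinner_diff_left[of 0 0 x] by simp

lemma cinner_sum_right: "cinner x (sum f I) = (\<Sum>i\<in>I. cinner x (f i :: 'a::complex_hilbert))"
  by (induction I rule: infinite_finite_induct) (auto simp: cinner_add_right)

lemma cinner_sum_left: "cinner (sum f I) x = (\<Sum>i\<in>I. cinner (f i :: 'a::complex_hilbert) x)"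
  by (induction I rule: infinite_finite_induct) (auto simp: cinner_add_left)

lemmas cinner_algebra = cinner_add_left cinner_add_right cinner_diff_left cinner_diff_right
  cinner_scaleC_left cinner_scaleC_right

lemma cinner_self: "cinner x x = of_real ((norm (x :: 'a::complex_hilbert))\<^sup>2)"
proof -
  have "Im (cinner x x) = 0"
    using cinner_commute[of x x] by (metis complex_cnj_cancel_iff Reals_cnj_iff complex_is_Real_iff)
  then show ?thesis
    by (simp add: complex_eq_iff inner_eq_Re_cinner[symmetric] power2_norm_eq_inner)
qed

lemma norm_eq_of_cinner_eq: "cinner x x = cinner y y \<Longrightarrow> norm (x :: 'a::complex_hilbert) = norm (y :: 'a)"
  unfolding cinner_self of_real_eq_iff by simp

lemma cinner_self_eq_0 [simp]: "cinner x x = 0 \<longleftrightarrow> x = (0 :: 'a::complex_hilbert)"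
  by (simp add: cinner_self)

lemma norm_scaleC [simp]: "norm (c *\<^sub>C (x :: 'a::complex_hilbert)) = cmod c * norm x"
proof -
  have "complex_of_real ((norm (c *\<^sub>C x))\<^sup>2) = complex_of_real ((cmod c * norm x)\<^sup>2)"
    unfolding cinner_self[symmetric] cinner_scaleC_left cinner_scaleC_right
    by (simp add: cinner_self power_mult_distrib complex_norm_square[symmetric] mult_ac)
  then show ?thesis
    unfolding of_real_eq_iff by (simp add: power2_eq_iff_nonneg)
qed

lemma cauchy_schwarz_cinner: "cmod (cinner x y) \<le> norm (x :: 'a::complex_hilbert) * norm y"
proof (cases "cinner x y = 0")
  case False
  \<comment> \<open>Rotating \<open>y\<close> by the phase of the product makes it real, where the real inequality applies.\<close>
  define c where "c = cnj (cinner x y) / cmod (cinner x y)"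
  have "cinner x (c *\<^sub>C y) = cmod (cinner x y)"
    using False by (simp add: c_def cinner_scaleC_right mult.commute complex_norm_square[symmetric] power2_eq_square)
  then have "cmod (cinner x y) = inner x (c *\<^sub>C y)"
    by (simp add: inner_eq_Re_cinner)
  also have "\<dots> \<le> norm x * norm (c *\<^sub>C y)"
    by (rule norm_cauchy_schwarz)
  also have "\<dots> = norm x * norm y"
    using False by (simp add: c_def norm_divide)
  finally show ?thesis .
qed simp

lemma cinner_scaleR_right: "cinner x (r *\<^sub>R y) = r *\<^sub>R cinner x (y :: 'a::complex_hilbert)"
  by (simp add: scaleC_of_real[symmetric] cinner_scaleC_right scaleR_conv_of_real)

lemma cinner_scaleR_left: "cinner (r *\<^sub>R x) y = r *\<^sub>R cinner x (y :: 'a::complex_hilbert)"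
  by (simp add: scaleC_of_real[symmetric] cinner_scaleC_left scaleR_conv_of_real)

lemma bounded_linear_cinner_right: "bounded_linear (cinner (x :: 'a::complex_hilbert))"
  by (rule bounded_linear_intro[where K = "norm x"])
     (auto simp: cinner_add_right cinner_scaleR_right intro: order_trans[OF cauchy_schwarz_cinner] simp: mult.commute)

lemma bounded_linear_cinner_left: "bounded_linear (\<lambda>x :: 'a::complex_hilbert. cinner x y)"
  by (rule bounded_linear_intro[where K = "norm y"])
     (auto simp: cinner_add_left cinner_scaleR_left cauchy_schwarz_cinner)

lemma scaleR_scaleC_commute: "r *\<^sub>R c *\<^sub>C x = c *\<^sub>C r *\<^sub>R (x :: 'a::complex_hilbert)"
  by (simp add: scaleC_of_real[symmetric] scaleC_scaleC mult.commute)

lemma bounded_linear_scaleC_right: "bounded_linear (\<lambda>x :: 'a::complex_hilbert. c *\<^sub>C x)"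
  by (rule bounded_linear_intro[where K = "cmod c"]) (auto simp: scaleC_add_right scaleR_scaleC_commute)

lemma bounded_linear_scaleC_left: "bounded_linear (\<lambda>c. c *\<^sub>C (x :: 'a::complex_hilbert))"
  by (rule bounded_linear_intro[where K = "norm x"])
     (auto simp: scaleC_add_left scaleR_conv_of_real scaleC_of_real[symmetric] scaleC_scaleC)

lemma cinner_eqI: "(\<And>z. cinner z x = cinner z y) \<Longrightarrow> x = (y :: 'a::complex_hilbert)"
  by (metis cinner_diff_right cinner_self_eq_0 eq_iff_diff_eq_0)

lemma norm_add_orthogonal:
  assumes "cinner x y = 0"
  shows "(norm (x + y))\<^sup>2 = (norm (x :: 'a::complex_hilbert))\<^sup>2 + (norm y)\<^sup>2"
proof -
  have "complex_of_real ((norm (x + y))\<^sup>2) = complex_of_real ((norm x)\<^sup>2 + (norm y)\<^sup>2)"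
    using assms cinner_commute[of x y]
    by (simp only: of_real_add cinner_self[symmetric] cinner_add_left cinner_add_right) simp
  then show ?thesis
    by (simp only: of_real_eq_iff)
qed

section \<open>Orthonormal families\<close>

text \<open>
  Families rather than sets, because an isometry is determined by two orthonormal families over the
  same index set, and exchanging the two gives the adjoint.
\<close>

definition orthonormal :: "'i set \<Rightarrow> ('i \<Rightarrow> 'a::complex_hilbert) \<Rightarrow> bool" where
  "orthonormal I e \<longleftrightarrow> (\<forall>i\<in>I. \<forall>j\<in>I. cinner (e i) (e j) = (if i = j then 1 else 0))"

lemma orthonormalD: "orthonormal I e \<Longrightarrow> i \<in> I \<Longrightarrow> j \<in> I \<Longrightarrow> cinner (e i) (e j) = (if i = j then 1 else 0)"
  by (auto simp: orthonormal_def)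

lemma orthonormal_subset: "orthonormal I e \<Longrightarrow> J \<subseteq> I \<Longrightarrow> orthonormal J e"
  unfolding orthonormal_def by blast

lemma orthonormal_norm: "orthonormal I e \<Longrightarrow> i \<in> I \<Longrightarrow> norm (e i) = 1"
  using orthonormalD[of I e i i] by (metis cinner_self norm_eq_1 norm_one of_real_eq_1_iff power2_norm_eq_inner)

lemma orthonormal_inj: "orthonormal I e \<Longrightarrow> inj_on e I"
  by (rule inj_onI) (metis orthonormalD zero_neq_one)

lemma orthonormal_image_iff: "inj_on g I \<Longrightarrow> orthonormal (g ` I) e \<longleftrightarrow> orthonormal I (e \<circ> g)"
  by (auto simp: orthonormal_def inj_on_eq_iff)

lemma norm_sum_orthonormal:
  assumes "orthonormal I e" "finite I"
  shows "(norm (\<Sum>i\<in>I. c i *\<^sub>C e i))\<^sup>2 = (\<Sum>i\<in>I. (cmod (c i))\<^sup>2)"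
proof -
  have "cinner (\<Sum>i\<in>I. c i *\<^sub>C e i) (\<Sum>j\<in>I. c j *\<^sub>C e j)
      = (\<Sum>j\<in>I. \<Sum>i\<in>I. if i = j then cnj (c i) * c j else 0)"
    unfolding cinner_sum_left cinner_sum_right
    by (auto intro!: sum.cong simp: cinner_algebra orthonormalD[OF assms(1)])
  also have "\<dots> = (\<Sum>j\<in>I. cnj (c j) * c j)"
    using assms by (intro sum.cong refl) (simp add: sum.delta)
  also have "\<dots> = of_real (\<Sum>i\<in>I. (cmod (c i))\<^sup>2)"
    by (simp add: complex_norm_square[unfolded of_real_power] mult.commute)
  finally show ?thesis
    unfolding cinner_self of_real_eq_iff .
qed

lemma bessel_finite:
  assumes "orthonormal I e" "finite I"
  shows "(\<Sum>i\<in>I. (cmod (cinner (e i) x))\<^sup>2) \<le> (norm x)\<^sup>2"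
proof -
  define y where "y = (\<Sum>i\<in>I. cinner (e i) x *\<^sub>C e i)"
  have "cinner (e i) y = cinner (e i) x" if "i \<in> I" for i
  proof -
    have "cinner (e i) y = (\<Sum>j\<in>I. if i = j then cinner (e j) x else 0)"
      unfolding y_def cinner_sum_right using that
      by (auto intro!: sum.cong simp: cinner_algebra orthonormalD[OF assms(1)])
    then show ?thesis using assms that by simp
  qed
  then have "cinner y (x - y) = 0"
    by (subst y_def) (simp add: cinner_sum_left cinner_algebra)
  then have "(norm x)\<^sup>2 = (norm y)\<^sup>2 + (norm (x - y))\<^sup>2"
    using norm_add_orthogonal[of y "x - y"] by simp
  then show ?thesis
    using norm_sum_orthonormal[OF assms, of "\<lambda>i. cinner (e i) x"] by (simp add: y_def)
qed

lemma bessel_summable: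
  assumes "orthonormal I e"
  shows "(\<lambda>i. (cmod (cinner (e i) x))\<^sup>2) summable_on I"
  using assms
  by (intro nonneg_bdd_above_summable_on bdd_aboveI[where M = "(norm x)\<^sup>2"])
     (auto intro: bessel_finite orthonormal_subset)

text \<open>
  By Pythagoras a block of \<open>\<Sum>i. c i e i\<close> has squared norm \<open>\<Sum>i. |c i|\<^sup>2\<close>, so the Cauchy property
  passes from the scalar series to the vector series.
\<close>

lemma summable_orthonormal:
  assumes e: "orthonormal I e" and c: "(\<lambda>i. (cmod (c i))\<^sup>2) summable_on I"
  shows "(\<lambda>i. c i *\<^sub>C e i) summable_on I"
proof -
  let ?f = "\<lambda>i. c i *\<^sub>C e i"
  let ?g = "\<lambda>i. (cmod (c i))\<^sup>2"
  have "\<exists>P. eventually P (finite_subsets_at_top I) \<and> (\<forall>F G. P F \<and> P G \<longrightarrow> dist (sum ?f F) (sum ?f G) < \<epsilon>)"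
    if "\<epsilon> > 0" for \<epsilon> :: real
  proof -
    have "\<forall>\<^sub>F F in finite_subsets_at_top I. dist (sum ?g F) (infsum ?g I) < (\<epsilon>/2)\<^sup>2"
      using infsum_tendsto[OF c] that by (auto simp: tendsto_iff)
    then obtain F0 where F0: "finite F0" "F0 \<subseteq> I"
      and close: "\<And>F. finite F \<Longrightarrow> F0 \<subseteq> F \<Longrightarrow> F \<subseteq> I \<Longrightarrow> dist (sum ?g F) (infsum ?g I) < (\<epsilon>/2)\<^sup>2"
      by (auto simp: eventually_finite_subsets_at_top)
    have tail: "norm (sum ?f (F - F0)) < \<epsilon>/2" if F: "finite F" "F0 \<subseteq> F" "F \<subseteq> I" for F
    proof -
      have "sum ?g F \<le> infsum ?g I"
        using F c by (intro finite_sum_le_infsum) auto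
      moreover have "dist (sum ?g F0) (infsum ?g I) < (\<epsilon>/2)\<^sup>2"
        using close F0 by auto
      moreover have "sum ?g (F - F0) = sum ?g F - sum ?g F0"
        using F F0 by (simp add: sum_diff)
      ultimately have "sum ?g (F - F0) < (\<epsilon>/2)\<^sup>2"
        by (simp add: dist_real_def)
      moreover have "F - F0 \<subseteq> I"
        using F by blast
      ultimately have "(norm (sum ?f (F - F0)))\<^sup>2 < (\<epsilon>/2)\<^sup>2"
        using norm_sum_orthonormal[OF orthonormal_subset[OF e], of "F - F0" c] F by simp
      then show ?thesis
        using power2_less_imp_less[of "norm (sum ?f (F - F0))" "\<epsilon>/2"] \<open>\<epsilon> > 0\<close> by simp
    qed
    have "dist (sum ?f F) (sum ?f G) < \<epsilon>"
      if "finite F \<and> F0 \<subseteq> F \<and> F \<subseteq> I" "finite G \<and> F0 \<subseteq> G \<and> G \<subseteq> I" for F G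
    proof -
      have "sum ?f F - sum ?f G = sum ?f (F - F0) - sum ?f (G - F0)"
        using that F0 by (simp add: sum_diff)
      then show ?thesis
        using tail[of F] tail[of G] that norm_triangle_ineq4[of "sum ?f (F - F0)" "sum ?f (G - F0)"]
        by (simp add: dist_norm)
    qed
    moreover have "\<forall>\<^sub>F F in finite_subsets_at_top I. finite F \<and> F0 \<subseteq> F \<and> F \<subseteq> I"
      using F0 by (auto simp: eventually_finite_subsets_at_top)
    ultimately show ?thesis
      by (intro exI[of _ "\<lambda>F. finite F \<and> F0 \<subseteq> F \<and> F \<subseteq> I"]) blast
  qed
  then have "cauchy_filter (filtermap (sum ?f) (finite_subsets_at_top I))"
    by (simp add: cauchy_filter_metric_filtermap)
  moreover have "complete (UNIV :: 'b set)"
    by (meson Cauchy_convergent UNIV_I complete_def convergent_def)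
  ultimately obtain L where "(sum ?f \<longlongrightarrow> L) (finite_subsets_at_top I)"
    using complete_uniform[where S = UNIV] by (force simp: filterlim_def)
  then show ?thesis
    using summable_on_def has_sum_def by blast
qed

definition closed_csubspace :: "'a::complex_hilbert set \<Rightarrow> bool" where
  "closed_csubspace M \<longleftrightarrow> closed M \<and> complex_vector.subspace M"

lemma closed_csubspace_orthogonal: "closed_csubspace {x :: 'a::complex_hilbert. \<forall>b\<in>B. cinner b x = 0}"
proof -
  have "closed {x. cinner b x = 0}" for b :: 'a
    using closed_Collect_eq[of "cinner b" "\<lambda>_. 0"] bounded_linear_cinner_right[of b]
    by (simp add: linear_continuous_on continuous_on_const)
  moreover have "{x. \<forall>b\<in>B. cinner b x = 0} = (\<Inter>b\<in>B. {x. cinner b x = 0})"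
    by auto
  ultimately have "closed {x. \<forall>b\<in>B. cinner b x = 0}"
    by auto
  then show ?thesis
    unfolding closed_csubspace_def by (auto intro!: complex_vector.subspaceI simp: cinner_algebra)
qed

lemma closed_csubspace_Int: "closed_csubspace M \<Longrightarrow> closed_csubspace N \<Longrightarrow> closed_csubspace (M \<inter> N)"
  by (auto simp: closed_csubspace_def complex_vector.subspace_inter)

lemma closed_csubspace_UNIV [simp]: "closed_csubspace UNIV"
  by (simp add: closed_csubspace_def)

lemma has_sum_in_closed_csubspace:
  assumes "closed_csubspace M" "(f has_sum x) I" "\<And>i. i \<in> I \<Longrightarrow> f i \<in> M"
  shows "x \<in> M"
proof (rule Lim_in_closed_set)
  show "(sum f \<longlongrightarrow> x) (finite_subsets_at_top I)" "closed M"
    using assms by (auto simp: has_sum_def closed_csubspace_def)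
  show "\<forall>\<^sub>F F in finite_subsets_at_top I. sum f F \<in> M"
    using assms by (intro eventually_finite_subsets_at_top_weakI complex_vector.subspace_sum)
      (auto simp: closed_csubspace_def)
qed simp

section \<open>Bounded complex-linear operators\<close>

lemma bounded_clinearI:
  assumes "\<And>x y. A (x + y) = A x + A y" "\<And>c x. A (c *\<^sub>C x) = c *\<^sub>C A x"
    and "\<And>x. norm (A x) \<le> K * norm (x :: 'a::complex_hilbert)"
  shows "bounded_clinear A"
  unfolding bounded_clinear_def
  by (auto intro!: bounded_linear_intro[where K = K] simp: assms scaleC_of_real[symmetric] mult.commute[of _ K])

lemma bounded_clinear_bounded_linear: "bounded_clinear A \<Longrightarrow> bounded_linear A"
  by (simp add: bounded_clinear_def)

lemma bounded_clinear_simps: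
  assumes "bounded_clinear A"
  shows "A (x + y) = A x + A y" "A (x - y) = A x - A y" "A (c *\<^sub>C x) = c *\<^sub>C A x" "A 0 = 0" "A (- x) = - A x"
  using assms linear_add linear_diff linear_0 linear_neg bounded_linear.linear
  unfolding bounded_clinear_def by metis+

lemma bounded_clinear_bound:
  assumes "bounded_clinear A"
  obtains K where "K \<ge> 0" "\<And>x. norm (A x) \<le> K * norm x"
  using bounded_linear.nonneg_bounded[OF bounded_clinear_bounded_linear[OF assms]] by (metis mult.commute)

lemma bounded_clinear_id: "bounded_clinear (\<lambda>x. x)"
  by (simp add: bounded_clinear_def bounded_linear_ident)

lemma bounded_clinear_zero: "bounded_clinear (\<lambda>x. 0)"
  by (auto simp: bounded_clinear_def)

lemma bounded_clinear_comp: "bounded_clinear A \<Longrightarrow> bounded_clinear B \<Longrightarrow> bounded_clinear (\<lambda>x. A (B x))"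
  by (auto simp: bounded_clinear_def intro: bounded_linear_compose)

lemma bounded_clinear_add: "bounded_clinear A \<Longrightarrow> bounded_clinear B \<Longrightarrow> bounded_clinear (\<lambda>x. A x + B x)"
  by (auto simp: bounded_clinear_def scaleC_add_right intro: bounded_linear_add)

lemma bounded_clinear_diff: "bounded_clinear A \<Longrightarrow> bounded_clinear B \<Longrightarrow> bounded_clinear (\<lambda>x. A x - B x)"
  by (auto simp: bounded_clinear_def complex_vector.scale_right_diff_distrib intro: bounded_linear_sub)

section \<open>Operators given by two orthonormal families\<close>

text \<open>
  For orthonormal families, the partial isometry with \<open>e i \<mapsto> f i\<close> that vanishes on the orthogonal
  complement of the \<open>e i\<close>.
\<close>

definition expand :: "'i set \<Rightarrow> ('i \<Rightarrow> 'a) \<Rightarrow> ('i \<Rightarrow> 'a) \<Rightarrow> 'a \<Rightarrow> 'a::complex_hilbert" where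
  "expand I e f x = (\<Sum>\<^sub>\<infinity>i\<in>I. cinner (e i) x *\<^sub>C f i)"

lemma has_sum_expand:
  assumes "orthonormal I e" "orthonormal I f"
  shows "((\<lambda>i. cinner (e i) x *\<^sub>C f i) has_sum expand I e f x) I"
  unfolding expand_def
  by (intro has_sum_infsum summable_orthonormal assms bessel_summable)

lemma norm_expand_le:
  assumes "orthonormal I e" "orthonormal I f"
  shows "norm (expand I e f x) \<le> norm x"
proof (rule Lim_norm_ubound)
  show "((\<lambda>F. \<Sum>i\<in>F. cinner (e i) x *\<^sub>C f i) \<longlongrightarrow> expand I e f x) (finite_subsets_at_top I)"
    using has_sum_expand[OF assms] by (simp add: has_sum_def)
  have "norm (\<Sum>i\<in>F. cinner (e i) x *\<^sub>C f i) \<le> norm x" if "finite F" "F \<subseteq> I" for F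
    using norm_sum_orthonormal[OF orthonormal_subset[OF assms(2) that(2)] that(1)]
      bessel_finite[OF orthonormal_subset[OF assms(1) that(2)] that(1), of x]
    by (auto intro: power2_le_imp_le[of _ "norm x"])
  then show "\<forall>\<^sub>F F in finite_subsets_at_top I. norm (\<Sum>i\<in>F. cinner (e i) x *\<^sub>C f i) \<le> norm x"
    by (intro eventually_finite_subsets_at_top_weakI) auto
qed simp

lemma bounded_clinear_expand:
  assumes "orthonormal I e" "orthonormal I f"
  shows "bounded_clinear (expand I e f)"
proof (rule bounded_clinearI[where K = 1])
  fix x y c
  show "expand I e f (x + y) = expand I e f x + expand I e f y"
    using has_sum_add[OF has_sum_expand[OF assms, of x] has_sum_expand[OF assms, of y]]
      has_sum_expand[OF assms, of "x + y"]
    by (simp add: cinner_add_right scaleC_add_left[symmetric] has_sum_iff)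
  show "expand I e f (c *\<^sub>C x) = c *\<^sub>C expand I e f x"
    using has_sum_bounded_linear[OF bounded_linear_scaleC_right has_sum_expand[OF assms, of x], of c]
      has_sum_expand[OF assms, of "c *\<^sub>C x"]
    by (simp add: cinner_scaleC_right scaleC_scaleC has_sum_iff)
qed (simp add: norm_expand_le assms)

lemma cinner_expand_left:
  assumes "orthonormal I e" "orthonormal I f"
  shows "cinner (expand I e f x) y = cinner x (expand I f e y)"
proof -
  have "((\<lambda>i. cinner (cinner (e i) x *\<^sub>C f i) y) has_sum cinner (expand I e f x) y) I"
    by (rule has_sum_bounded_linear[OF bounded_linear_cinner_left has_sum_expand[OF assms]])
  moreover have "((\<lambda>i. cinner x (cinner (f i) y *\<^sub>C e i)) has_sum cinner x (expand I f e y)) I"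
    by (rule has_sum_bounded_linear[OF bounded_linear_cinner_right has_sum_expand[OF assms(2,1)]])
  moreover have "cinner (cinner (e i) x *\<^sub>C f i) y = cinner x (cinner (f i) y *\<^sub>C e i)" for i
    using cinner_commute[of x "e i"] by (simp add: cinner_algebra mult.commute)
  ultimately show ?thesis
    using has_sum_unique by force
qed

lemma expand_apply:
  assumes "orthonormal I e" "i \<in> I"
  shows "expand I e f (e i) = f i"
proof -
  have "expand I e f (e i) = (\<Sum>\<^sub>\<infinity>j\<in>{i}. cinner (e j) (e i) *\<^sub>C f j)"
    unfolding expand_def using assms
    by (intro infsum_cong_neutral) (auto simp: orthonormalD[OF assms(1)])
  then show ?thesis
    using assms by (simp add: orthonormalD[OF assms(1)])
qed

lemma cinner_expand:
  assumes "orthonormal I e" "orthonormal I f" "i \<in> I"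
  shows "cinner (f i) (expand I e f x) = cinner (e i) x"
  using cinner_expand_left[OF assms(2,1), of "f i" x] assms by (simp add: expand_apply)

lemma expand_expand:
  assumes "orthonormal I e" "orthonormal I f"
  shows "expand I f g (expand I e f x) = expand I e g x"
  unfolding expand_def[of I f g] expand_def[of I e g]
  by (intro infsum_cong) (simp add: cinner_expand assms)

lemma expand_eq_0: "(\<And>i. i \<in> I \<Longrightarrow> cinner (e i) x = 0) \<Longrightarrow> expand I e f x = 0"
  unfolding expand_def by (intro infsum_0) simp

lemma expand_in_closed_csubspace:
  assumes "orthonormal I e" "orthonormal I f" "closed_csubspace M" "\<And>i. i \<in> I \<Longrightarrow> f i \<in> M"
  shows "expand I e f x \<in> M"
  using assms complex_vector.subspace_scale
  by (intro has_sum_in_closed_csubspace[OF assms(3) has_sum_expand]) (auto simp: closed_csubspace_def)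

section \<open>Orthonormal bases of subspaces\<close>

lemma orthonormal_insert:
  assumes B: "orthonormal B (\<lambda>x. x)" and c: "norm c = 1" "\<And>b. b \<in> B \<Longrightarrow> cinner b c = (0 :: complex)"
  shows "c \<notin> B" "orthonormal (insert c B) (\<lambda>x. x)"
proof -
  have c': "cinner c b = 0" if "b \<in> B" for b
    using c(2)[OF that] cinner_commute[of c b] by simp
  show "c \<notin> B"
    using c cinner_self[of c] by force
  with B c c' show "orthonormal (insert c B) (\<lambda>x. x)"
    unfolding orthonormal_def by (auto simp: cinner_self)
qed

text \<open>
  Maximality of the family inside \<open>M\<close>, which for closed \<open>M\<close> says that the span of
  the family is dense in \<open>M\<close>.
\<close>

definition basis_of :: "'a::complex_hilbert set \<Rightarrow> 'i set \<Rightarrow> ('i \<Rightarrow> 'a) \<Rightarrow> bool" where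
  "basis_of M I e \<longleftrightarrow> orthonormal I e \<and> e ` I \<subseteq> M \<and> (\<forall>x\<in>M. (\<forall>i\<in>I. cinner (e i) x = 0) \<longrightarrow> x = 0)"

lemma basis_of_orthonormal: "basis_of M I e \<Longrightarrow> orthonormal I e"
  by (simp add: basis_of_def)

lemma basis_of_in: "basis_of M I e \<Longrightarrow> i \<in> I \<Longrightarrow> e i \<in> M"
  by (auto simp: basis_of_def)

lemma basis_of_eq_0: "basis_of M I e \<Longrightarrow> x \<in> M \<Longrightarrow> (\<And>i. i \<in> I \<Longrightarrow> cinner (e i) x = 0) \<Longrightarrow> x = 0"
  by (auto simp: basis_of_def)

lemma basis_of_image: "basis_of M I e \<Longrightarrow> basis_of M (e ` I) (\<lambda>x. x)"
  by (auto simp: basis_of_def orthonormal_image_iff[OF orthonormal_inj] o_def)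

lemma expand_basis:
  assumes "basis_of M I e" "closed_csubspace M" "x \<in> M"
  shows "expand I e e x = x"
proof -
  note e = basis_of_orthonormal[OF assms(1)]
  have "expand I e e x \<in> M"
    using assms by (intro expand_in_closed_csubspace e) (auto dest: basis_of_in)
  then have "x - expand I e e x \<in> M"
    using assms by (auto simp: closed_csubspace_def intro: complex_vector.subspace_diff)
  then have "x - expand I e e x = 0"
    by (rule basis_of_eq_0[OF assms(1)]) (simp add: cinner_diff_right cinner_expand e)
  then show ?thesis by simp
qed

lemma parseval:
  assumes "basis_of M I e" "closed_csubspace M" "x \<in> M"
  shows "((\<lambda>i. (cmod (cinner (e i) x))\<^sup>2) has_sum (norm x)\<^sup>2) I"
proof -
  note e = basis_of_orthonormal[OF assms(1)]
  have "((\<lambda>i. cinner x (cinner (e i) x *\<^sub>C e i)) has_sum cinner x (expand I e e x)) I"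
    by (rule has_sum_bounded_linear[OF bounded_linear_cinner_right has_sum_expand[OF e e]])
  then have "((\<lambda>i. Re (cinner x (cinner (e i) x *\<^sub>C e i))) has_sum Re (cinner x x)) I"
    by (simp add: expand_basis[OF assms] has_sum_Re)
  moreover have "cinner x (cinner (e i) x *\<^sub>C e i) = of_real ((cmod (cinner (e i) x))\<^sup>2)" for i
    using cinner_commute[of x "e i"] by (simp only: cinner_scaleC_right complex_norm_square)
  ultimately show ?thesis
    by (simp add: cinner_self)
qed

text \<open>
  One application of Zorn's lemma serves every basis below; \<open>C\<close> is the set of vectors that are allowed
  (those of a subspace, the eigenvectors of an operator, or only its eigenvectors fixed by a conjugation).
\<close>

lemma maximal_orthonormal_set:
  assumes ext: "\<And>B. B \<subseteq> C \<Longrightarrow> orthonormal B (\<lambda>x. x) \<Longrightarrow> \<not> P B \<Longrightarrow>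
      \<exists>c\<in>C. norm c = 1 \<and> (\<forall>b\<in>B. cinner b c = (0 :: complex))"
  shows "\<exists>B :: 'a::complex_hilbert set. B \<subseteq> C \<and> orthonormal B (\<lambda>x. x) \<and> P B"
proof -
  let ?A = "{B :: 'a set. B \<subseteq> C \<and> orthonormal B (\<lambda>x. x)}"
  have "\<Union>K \<in> ?A" if K: "subset.chain ?A K" for K
  proof -
    have "cinner x y = (if x = y then 1 else 0)" if xy: "x \<in> X" "X \<in> K" "y \<in> Y" "Y \<in> K" for x y X Y
    proof -
      obtain Z where "Z \<in> K" "x \<in> Z" "y \<in> Z"
        using K xy unfolding subset_chain_def by blast
      moreover have "orthonormal Z (\<lambda>x. x)"
        using K \<open>Z \<in> K\<close> unfolding subset_chain_def by blast
      ultimately show ?thesis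
        by (simp add: orthonormal_def)
    qed
    then show ?thesis
      using K unfolding subset_chain_def orthonormal_def by blast
  qed
  then obtain B where B: "B \<subseteq> C" "orthonormal B (\<lambda>x. x)"
      and max: "\<And>X. X \<subseteq> C \<Longrightarrow> orthonormal X (\<lambda>x. x) \<Longrightarrow> B \<subseteq> X \<Longrightarrow> X = B"
    using subset_Zorn'[of ?A] by auto
  have "P B"
  proof (rule ccontr)
    assume "\<not> P B"
    from ext[OF B this] obtain c where c: "c \<in> C" "norm c = 1" "\<And>b. b \<in> B \<Longrightarrow> cinner b c = 0"
      by blast
    then have "c \<notin> B" "orthonormal (insert c B) (\<lambda>x. x)"
      using orthonormal_insert[OF B(2) c(2)] by auto
    then have "insert c B = B"
      using B c by (intro max) auto
    then show False
      using \<open>c \<notin> B\<close> by blast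
  qed
  with B show ?thesis by blast
qed

lemma norm_normalize:
  assumes "x \<noteq> (0 :: 'a::complex_hilbert)"
  shows "norm ((1 / norm x) *\<^sub>C x) = 1"
  using assms by (simp add: norm_divide)

lemma basis_exists:
  assumes "complex_vector.subspace (M :: 'a::complex_hilbert set)"
  obtains B where "B \<subseteq> M" "basis_of M B (\<lambda>x. x)"
proof -
  let ?P = "\<lambda>B. \<forall>x\<in>M. (\<forall>b\<in>B. cinner b x = 0) \<longrightarrow> x = 0"
  have "\<exists>c\<in>M. norm c = 1 \<and> (\<forall>b\<in>B. cinner b c = 0)" if "\<not> ?P B" for B
  proof -
    from that obtain x where x: "x \<in> M" "\<forall>b\<in>B. cinner b x = 0" "x \<noteq> 0"
      by blast
    then have "(1 / norm x) *\<^sub>C x \<in> M"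
      using assms complex_vector.subspace_scale by blast
    then show ?thesis
      using x norm_normalize[of x] by (intro bexI[of _ "(1 / norm x) *\<^sub>C x"]) (auto simp: cinner_algebra)
  qed
  then have "\<exists>B. B \<subseteq> M \<and> orthonormal B (\<lambda>x. x) \<and> ?P B"
    by (intro maximal_orthonormal_set)
  then show ?thesis
    using that by (auto simp: basis_of_def)
qed

lemma orthonormal_basis_iff: "orthonormal_basis E \<longleftrightarrow> basis_of UNIV E (\<lambda>x. x :: 'a::complex_hilbert)"
proof
  assume E: "orthonormal_basis E"
  have "x = 0" if x: "\<forall>e\<in>E. cinner e x = 0" for x
  proof -
    let ?N = "{y. \<forall>b\<in>{x}. cinner b y = 0}"
    have N: "closed_csubspace ?N"
      by (rule closed_csubspace_orthogonal)
    have "E \<subseteq> ?N"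
      using x cinner_commute[of x] by auto
    then have "complex_vector.span E \<subseteq> ?N"
      using N by (intro complex_vector.span_minimal) (auto simp: closed_csubspace_def)
    then have "closure (complex_vector.span E) \<subseteq> ?N"
      using N by (intro closure_minimal) (auto simp: closed_csubspace_def)
    then have "x \<in> ?N"
      using E unfolding orthonormal_basis_def by blast
    then show "x = 0"
      by simp
  qed
  with E show "basis_of UNIV E (\<lambda>x. x)"
    by (auto simp: basis_of_def orthonormal_def orthonormal_basis_def)
next
  assume E: "basis_of UNIV E (\<lambda>x. x)"
  have "x \<in> closure (complex_vector.span E)" for x
  proof (rule Lim_in_closed_set)
    note on = basis_of_orthonormal[OF E]
    show "((\<lambda>F. \<Sum>i\<in>F. cinner i x *\<^sub>C i) \<longlongrightarrow> x) (finite_subsets_at_top E)"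
      using has_sum_expand[OF on on, of x] expand_basis[OF E, of x] by (simp add: has_sum_def)
    have "(\<Sum>i\<in>F. cinner i x *\<^sub>C i) \<in> complex_vector.span E" if "F \<subseteq> E" for F
      using that by (intro complex_vector.span_sum complex_vector.span_scale complex_vector.span_base) auto
    then show "\<forall>\<^sub>F F in finite_subsets_at_top E. (\<Sum>i\<in>F. cinner i x *\<^sub>C i) \<in> closure (complex_vector.span E)"
      using closure_subset by (intro eventually_finite_subsets_at_top_weakI) blast
  qed auto
  then show "orthonormal_basis E"
    using E by (auto simp: basis_of_def orthonormal_def orthonormal_basis_def)
qed

section \<open>Adjoints\<close>

text \<open>
  The adjoint is built coordinatewise: testing \<open>A\<close> on \<open>\<Sum>e\<in>F. \<langle>A e, y\<rangle> e\<close> bounds the partial sums of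
  \<open>\<Sum>e. |\<langle>A e, y\<rangle>|\<^sup>2\<close>, so these numbers are the coordinates of a vector.
\<close>

lemma adjoint_exists:
  assumes A: "bounded_clinear (A :: 'a::complex_hilbert \<Rightarrow> 'a)"
  shows "\<exists>B. \<forall>x y. cinner (A x) y = cinner x (B y)"
proof -
  obtain K where K: "K \<ge> 0" "\<And>x. norm (A x) \<le> K * norm x"
    using bounded_clinear_bound[OF A] by blast
  obtain E where E: "basis_of UNIV E (\<lambda>x. x :: 'a)"
    using basis_exists[of UNIV] by (auto simp: complex_vector.subspace_UNIV)
  note on = basis_of_orthonormal[OF E]
  have summ: "(\<lambda>e. (cmod (cinner (A e) y))\<^sup>2) summable_on E" for y
  proof (rule nonneg_bdd_above_summable_on)
    have "(\<Sum>e\<in>F. (cmod (cinner (A e) y))\<^sup>2) \<le> (K * norm y)\<^sup>2" if F: "F \<subseteq> E" "finite F" for F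
    proof -
      define z where "z = (\<Sum>e\<in>F. cinner (A e) y *\<^sub>C e)"
      have nz: "(norm z)\<^sup>2 = (\<Sum>e\<in>F. (cmod (cinner (A e) y))\<^sup>2)"
        unfolding z_def by (rule norm_sum_orthonormal[OF orthonormal_subset[OF on F(1)] F(2)])
      have "A z = (\<Sum>e\<in>F. cinner (A e) y *\<^sub>C A e)"
        using bounded_linear.linear[OF bounded_clinear_bounded_linear[OF A]]
        by (simp add: z_def linear_sum bounded_clinear_simps[OF A])
      then have "cinner (A z) y = (\<Sum>e\<in>F. cnj (cinner (A e) y) * cinner (A e) y)"
        by (simp add: cinner_sum_left cinner_scaleC_left)
      also have "\<dots> = of_real ((norm z)\<^sup>2)"
        unfolding nz of_real_sum by (simp only: complex_norm_square mult.commute)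
      finally have "(norm z)\<^sup>2 = cmod (cinner (A z) y)"
        by (simp add: norm_power)
      also have "\<dots> \<le> K * norm z * norm y"
        using cauchy_schwarz_cinner[of "A z" y] K(2)[of z] by (meson mult_right_mono norm_ge_zero order_trans)
      finally have "norm z * norm z \<le> (K * norm y) * norm z"
        by (simp add: power2_eq_square mult_ac)
      then have "norm z \<le> K * norm y"
        using K by (cases "norm z = 0") auto
      then have "(norm z)\<^sup>2 \<le> (K * norm y)\<^sup>2"
        by (intro power_mono) auto
      then show ?thesis by (simp add: nz)
    qed
    then show "bdd_above (sum (\<lambda>e. (cmod (cinner (A e) y))\<^sup>2) ` {F. F \<subseteq> E \<and> finite F})"
      by (intro bdd_aboveI) auto
  qed auto
  define B where "B y = (\<Sum>\<^sub>\<infinity>e\<in>E. cinner (A e) y *\<^sub>C e)" for y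
  have B: "((\<lambda>e. cinner (A e) y *\<^sub>C e) has_sum B y) E" for y
    unfolding B_def by (intro has_sum_infsum summable_orthonormal on summ)
  have "cinner (A x) y = cinner x (B y)" for x y
  proof -
    have "((\<lambda>e. cinner x (cinner (A e) y *\<^sub>C e)) has_sum cinner x (B y)) E"
      by (rule has_sum_bounded_linear[OF bounded_linear_cinner_right B])
    moreover have "bounded_linear (\<lambda>x. cinner (A x) y)"
      by (rule bounded_linear_compose[OF bounded_linear_cinner_left bounded_clinear_bounded_linear[OF A]])
    then have "((\<lambda>e. cinner (A (cinner e x *\<^sub>C e)) y) has_sum cinner (A (expand E (\<lambda>x. x) (\<lambda>x. x) x)) y) E"
      by (rule has_sum_bounded_linear[OF _ has_sum_expand[OF on on]])
    moreover have "cinner (A (cinner e x *\<^sub>C e)) y = cinner x (cinner (A e) y *\<^sub>C e)" for e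
      using cinner_commute[of x e] by (simp add: bounded_clinear_simps[OF A] cinner_algebra mult.commute)
    ultimately show ?thesis
      using has_sum_unique expand_basis[OF E, of x] by force
  qed
  then show ?thesis by blast
qed

lemma cadjointI:
  assumes "\<And>x y. cinner (A x) y = cinner x (B y)"
  shows "cadjoint A = B"
  unfolding cadjoint_def
proof (rule the_equality)
  fix B' assume "\<forall>x y. cinner (A x) y = cinner x (B' y)"
  then show "B' = B"
    by (intro ext cinner_eqI) (metis assms)
qed (simp add: assms)

lemma cinner_cadjoint:
  assumes "bounded_clinear A"
  shows "cinner x (cadjoint A y) = cinner (A x) y" "cinner (cadjoint A x) y = cinner x (A y)"
proof -
  obtain B where B: "\<And>x y. cinner (A x) y = cinner x (B y)"
    using adjoint_exists[OF assms] by blast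
  then have "cadjoint A = B"
    by (rule cadjointI)
  with B show "cinner x (cadjoint A y) = cinner (A x) y"
    by simp
  then show "cinner (cadjoint A x) y = cinner x (A y)"
    unfolding cinner_commute[of "cadjoint A x"] cinner_commute[of x "A y"]
    using B \<open>cadjoint A = B\<close> by simp
qed

lemma bounded_clinear_cadjoint:
  assumes A: "bounded_clinear A"
  shows "bounded_clinear (cadjoint A)"
proof -
  obtain K where K: "K \<ge> 0" "\<And>x. norm (A x) \<le> K * norm x"
    using bounded_clinear_bound[OF A] by blast
  have "norm (cadjoint A y) \<le> K * norm y" for y
  proof -
    let ?z = "cadjoint A y"
    have "cinner (A ?z) y = of_real ((norm ?z)\<^sup>2)"
      using cinner_cadjoint(1)[OF A, of ?z y] by (simp only: cinner_self)
    then have "(norm ?z)\<^sup>2 = cmod (cinner (A ?z) y)"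
      by (simp add: norm_power)
    also have "\<dots> \<le> K * norm ?z * norm y"
      using cauchy_schwarz_cinner[of "A ?z" y] K(2)[of ?z] by (meson mult_right_mono norm_ge_zero order_trans)
    finally have "norm ?z * norm ?z \<le> (K * norm y) * norm ?z"
      by (simp add: power2_eq_square mult_ac)
    then show ?thesis
      using K by (cases "norm ?z = 0") auto
  qed
  then show ?thesis
    by (intro bounded_clinearI[where K = K] cinner_eqI) (simp_all add: cinner_algebra cinner_cadjoint[OF A])
qed

lemma cadjoint_cadjoint: "bounded_clinear A \<Longrightarrow> cadjoint (cadjoint A) = A"
  by (rule cadjointI) (simp add: cinner_cadjoint)

lemma cadjoint_comp:
  assumes "bounded_clinear A" "bounded_clinear B"
  shows "cadjoint (\<lambda>x. A (B x)) = (\<lambda>x. cadjoint B (cadjoint A x))"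
  by (rule cadjointI) (simp add: cinner_cadjoint assms)

section \<open>Hilbert--Schmidt operators\<close>

text \<open>
  Expand each \<open>A\<^sup>* f\<^sub>i\<close> by Parseval's identity, exchange the sums, and apply Bessel's inequality to each
  \<open>A e\<close>.
\<close>

lemma sum_norm_cadjoint_le:
  assumes A: "bounded_clinear (A :: 'a::complex_hilbert \<Rightarrow> 'a)" and E: "basis_of UNIV E (\<lambda>x. x)"
    and summ: "(\<lambda>e. (norm (A e))\<^sup>2) summable_on E"
    and F: "finite F" "orthonormal F f"
  shows "(\<Sum>i\<in>F. (norm (cadjoint A (f i)))\<^sup>2) \<le> (\<Sum>\<^sub>\<infinity>e\<in>E. (norm (A e))\<^sup>2)"
proof (rule has_sum_mono)
  have "((\<lambda>e. \<Sum>i\<in>G. (cmod (cinner e (cadjoint A (f i))))\<^sup>2) has_sum (\<Sum>i\<in>G. (norm (cadjoint A (f i)))\<^sup>2)) E"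
    if "finite G" for G
    using that
  proof (induction G)
    case (insert i G)
    then show ?case
      using has_sum_add[OF parseval[OF E closed_csubspace_UNIV UNIV_I, of "cadjoint A (f i)"] insert.IH] by simp
  qed simp
  then show "((\<lambda>e. \<Sum>i\<in>F. (cmod (cinner e (cadjoint A (f i))))\<^sup>2) has_sum (\<Sum>i\<in>F. (norm (cadjoint A (f i)))\<^sup>2)) E"
    using F by blast
  show "((\<lambda>e. (norm (A e))\<^sup>2) has_sum (\<Sum>\<^sub>\<infinity>e\<in>E. (norm (A e))\<^sup>2)) E"
    using summ by simp
  fix e
  have "cmod (cinner e (cadjoint A (f i))) = cmod (cinner (f i) (A e))" for i
    using cmod_cinner_commute[of "A e"] by (simp add: cinner_cadjoint[OF A])
  then show "(\<Sum>i\<in>F. (cmod (cinner e (cadjoint A (f i))))\<^sup>2) \<le> (norm (A e))\<^sup>2"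
    using bessel_finite[OF F(2,1), of "A e"] by simp
qed

text \<open>
  Testing all finite orthonormal sets, instead of one basis, makes sums and products with bounded
  operators on the left immediate.
\<close>

definition hs_bounded :: "('a::complex_hilbert \<Rightarrow> 'b::real_normed_vector) \<Rightarrow> bool" where
  "hs_bounded A \<longleftrightarrow> (\<exists>C. \<forall>F. finite F \<and> orthonormal F (\<lambda>x. x) \<longrightarrow> (\<Sum>x\<in>F. (norm (A x))\<^sup>2) \<le> C)"

lemma hs_bounded_summable:
  assumes "hs_bounded A" "orthonormal I e"
  shows "(\<lambda>i. (norm (A (e i)))\<^sup>2) summable_on I"
proof -
  obtain C where C: "\<And>F. finite F \<Longrightarrow> orthonormal F (\<lambda>x. x) \<Longrightarrow> (\<Sum>x\<in>F. (norm (A x))\<^sup>2) \<le> C"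
    using assms(1) by (auto simp: hs_bounded_def)
  have "(\<Sum>i\<in>F. (norm (A (e i)))\<^sup>2) \<le> C" if "finite F" "F \<subseteq> I" for F
  proof -
    note F = orthonormal_subset[OF assms(2) that(2)]
    have "(\<Sum>i\<in>F. (norm (A (e i)))\<^sup>2) = (\<Sum>x\<in>e ` F. (norm (A x))\<^sup>2)"
      by (subst sum.reindex[OF orthonormal_inj[OF F]]) simp
    also have "\<dots> \<le> C"
      using F that by (intro C) (auto simp: orthonormal_image_iff[OF orthonormal_inj] o_def)
    finally show ?thesis .
  qed
  then show ?thesis
    by (intro nonneg_bdd_above_summable_on bdd_aboveI[where M = C]) auto
qed

lemma hilbert_schmidt_cadjoint_bounded:
  assumes "bounded_clinear (A :: 'a::complex_hilbert \<Rightarrow> 'a)" "basis_of UNIV E (\<lambda>x. x)"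
    and "(\<lambda>e. (norm (A e))\<^sup>2) summable_on E"
  shows "hs_bounded (cadjoint A)"
  unfolding hs_bounded_def using sum_norm_cadjoint_le[OF assms] by blast

text \<open>Passing from \<open>A\<close> to \<open>A\<^sup>*\<close> and back trades summability over one basis for a bound over all orthonormal sets.\<close>

lemma hilbert_schmidt_iff: "hilbert_schmidt A \<longleftrightarrow> bounded_clinear A \<and> hs_bounded (A :: 'a::complex_hilbert \<Rightarrow> 'a)"
proof
  assume "hilbert_schmidt A"
  then obtain E where A: "bounded_clinear A" and E: "basis_of UNIV E (\<lambda>x. x)"
    and summ: "(\<lambda>e. (norm (A e))\<^sup>2) summable_on E"
    by (auto simp: hilbert_schmidt_def orthonormal_basis_iff)
  have "(\<lambda>e. (norm (cadjoint A e))\<^sup>2) summable_on E"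
    by (rule hs_bounded_summable[OF hilbert_schmidt_cadjoint_bounded[OF A E summ] basis_of_orthonormal[OF E]])
  then show "bounded_clinear A \<and> hs_bounded A"
    using hilbert_schmidt_cadjoint_bounded[OF bounded_clinear_cadjoint[OF A] E] A by (simp add: cadjoint_cadjoint)
next
  assume A: "bounded_clinear A \<and> hs_bounded A"
  obtain E where E: "basis_of UNIV E (\<lambda>x. x :: 'a)"
    using basis_exists[of UNIV] by (auto simp: complex_vector.subspace_UNIV)
  then show "hilbert_schmidt A"
    unfolding hilbert_schmidt_def orthonormal_basis_iff
    using A hs_bounded_summable[of A E "\<lambda>x. x"] basis_of_orthonormal[OF E] by auto
qed

lemma hilbert_schmidt_bounded_clinear: "hilbert_schmidt A \<Longrightarrow> bounded_clinear A"
  by (simp add: hilbert_schmidt_def)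

lemma hilbert_schmidt_summable:
  "hilbert_schmidt A \<Longrightarrow> orthonormal I e \<Longrightarrow> (\<lambda>i. (norm (A (e i)))\<^sup>2) summable_on I"
  by (simp add: hilbert_schmidt_iff hs_bounded_summable)

lemma hilbert_schmidtI:
  assumes "bounded_clinear A" "basis_of UNIV I e" "(\<lambda>i. (norm (A (e i)))\<^sup>2) summable_on I"
  shows "hilbert_schmidt A"
proof -
  have "(\<lambda>x. (norm (A x))\<^sup>2) summable_on e ` I"
    using assms(3) orthonormal_inj[OF basis_of_orthonormal[OF assms(2)]]
    by (simp add: summable_on_reindex o_def)
  then show ?thesis
    using assms basis_of_image[OF assms(2)] unfolding hilbert_schmidt_def orthonormal_basis_iff by blast
qed

lemma hilbert_schmidt_cadjoint: "hilbert_schmidt A \<Longrightarrow> hilbert_schmidt (cadjoint A)"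
  unfolding hilbert_schmidt_iff[of "cadjoint A"]
  by (auto simp: hilbert_schmidt_def orthonormal_basis_iff bounded_clinear_cadjoint hilbert_schmidt_cadjoint_bounded)

lemma hs_bounded_mono:
  assumes "hs_bounded A" "\<And>x. norm (B x) \<le> K * norm (A x)"
  shows "hs_bounded B"
proof -
  obtain C where C: "\<And>F. finite F \<Longrightarrow> orthonormal F (\<lambda>x. x) \<Longrightarrow> (\<Sum>x\<in>F. (norm (A x))\<^sup>2) \<le> C"
    using assms(1) by (auto simp: hs_bounded_def)
  have "(\<Sum>x\<in>F. (norm (B x))\<^sup>2) \<le> K\<^sup>2 * C" if F: "finite F" "orthonormal F (\<lambda>x. x)" for F
  proof -
    have "(\<Sum>x\<in>F. (norm (B x))\<^sup>2) \<le> (\<Sum>x\<in>F. K\<^sup>2 * (norm (A x))\<^sup>2)"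
      unfolding power_mult_distrib[symmetric] using assms(2) by (intro sum_mono power_mono) auto
    also have "\<dots> \<le> K\<^sup>2 * C"
      unfolding sum_distrib_left[symmetric] using C[OF F] by (intro mult_left_mono) auto
    finally show ?thesis .
  qed
  then show ?thesis
    unfolding hs_bounded_def by blast
qed

lemma hs_bounded_add:
  assumes "hs_bounded A" "hs_bounded B"
  shows "hs_bounded (\<lambda>x. A x + B x)"
proof -
  obtain C where C: "\<And>F. finite F \<Longrightarrow> orthonormal F (\<lambda>x. x) \<Longrightarrow> (\<Sum>x\<in>F. (norm (A x))\<^sup>2) \<le> C"
    using assms(1) by (auto simp: hs_bounded_def)
  obtain D where D: "\<And>F. finite F \<Longrightarrow> orthonormal F (\<lambda>x. x) \<Longrightarrow> (\<Sum>x\<in>F. (norm (B x))\<^sup>2) \<le> D"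
    using assms(2) by (auto simp: hs_bounded_def)
  have "(norm (A x + B x))\<^sup>2 \<le> 2 * (norm (A x))\<^sup>2 + 2 * (norm (B x))\<^sup>2" for x
  proof -
    have "(norm (A x + B x))\<^sup>2 \<le> (norm (A x) + norm (B x))\<^sup>2"
      by (intro power_mono norm_triangle_ineq) auto
    then show ?thesis
      using sum_squares_bound[of "norm (A x)" "norm (B x)"] by (simp add: power2_sum)
  qed
  then have "(\<Sum>x\<in>F. (norm (A x + B x))\<^sup>2) \<le> 2 * C + 2 * D" if "finite F" "orthonormal F (\<lambda>x. x)" for F
    using C[OF that] D[OF that]
      sum_mono[of F "\<lambda>x. (norm (A x + B x))\<^sup>2" "\<lambda>x. 2 * (norm (A x))\<^sup>2 + 2 * (norm (B x))\<^sup>2"]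
    by (simp add: sum.distrib sum_distrib_left[symmetric])
  then show ?thesis
    unfolding hs_bounded_def by blast
qed

lemma hilbert_schmidt_add: "hilbert_schmidt A \<Longrightarrow> hilbert_schmidt B \<Longrightarrow> hilbert_schmidt (\<lambda>x. A x + B x)"
  by (simp add: hilbert_schmidt_iff bounded_clinear_add hs_bounded_add)

lemma hilbert_schmidt_comp_left:
  assumes "bounded_clinear B" "hilbert_schmidt A"
  shows "hilbert_schmidt (\<lambda>x. B (A x))"
  using assms bounded_clinear_bound[OF assms(1)] hs_bounded_mono[of A "\<lambda>x. B (A x)"]
  by (metis hilbert_schmidt_iff bounded_clinear_comp)

lemma hilbert_schmidt_uminus: "hilbert_schmidt A \<Longrightarrow> hilbert_schmidt (\<lambda>x. - A x)"
  using hilbert_schmidt_comp_left[of "\<lambda>x. 0 - x" A, OF bounded_clinear_diff]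
  by (simp add: bounded_clinear_id bounded_clinear_zero)

lemma hilbert_schmidt_diff: "hilbert_schmidt A \<Longrightarrow> hilbert_schmidt B \<Longrightarrow> hilbert_schmidt (\<lambda>x. A x - B x)"
  using hilbert_schmidt_add[OF _ hilbert_schmidt_uminus] by simp

lemma hilbert_schmidt_comp_right:
  assumes "bounded_clinear B" "hilbert_schmidt A"
  shows "hilbert_schmidt (\<lambda>x. A (B x))"
proof -
  note A = hilbert_schmidt_bounded_clinear[OF assms(2)]
  have "hilbert_schmidt (\<lambda>x. cadjoint B (cadjoint A x))"
    by (rule hilbert_schmidt_comp_left[OF bounded_clinear_cadjoint[OF assms(1)] hilbert_schmidt_cadjoint[OF assms(2)]])
  then have "hilbert_schmidt (cadjoint (\<lambda>x. A (B x)))"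
    by (simp add: cadjoint_comp[OF A assms(1)])
  from hilbert_schmidt_cadjoint[OF this] show ?thesis
    by (simp add: cadjoint_cadjoint[OF bounded_clinear_comp[OF A assms(1)]])
qed

section \<open>Eigenvectors of self-adjoint Hilbert--Schmidt operators\<close>

text \<open>
  If the finite orthonormal set \<open>F\<close> nearly attains the supremum of \<open>\<Sum>f\<in>F. \<parallel>A f\<parallel>\<^sup>2\<close>, then enlarging it by
  a unit vector orthogonal to \<open>F\<close> can add only little.
\<close>

lemma hilbert_schmidt_small_on_complement:
  assumes A: "hilbert_schmidt (A :: 'a::complex_hilbert \<Rightarrow> 'a)" and \<epsilon>: "\<epsilon> > 0"
  obtains F where "finite F" "orthonormal F (\<lambda>x. x)"
    "\<And>y. (\<And>f. f \<in> F \<Longrightarrow> cinner f y = 0) \<Longrightarrow> norm (A y) \<le> \<epsilon> * norm y"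
proof -
  let ?F = "{F :: 'a set. finite F \<and> orthonormal F (\<lambda>x. x)}"
  let ?s = "\<lambda>F. \<Sum>x\<in>F. (norm (A x))\<^sup>2"
  have bdd: "bdd_above (?s ` ?F)"
    using A unfolding hilbert_schmidt_iff hs_bounded_def bdd_above_def by blast
  have ne: "?s ` ?F \<noteq> {}"
    by (auto simp: orthonormal_def intro: exI[of _ "{}"])
  have "\<exists>F\<in>?F. (SUP F\<in>?F. ?s F) - \<epsilon>\<^sup>2 < ?s F"
    using less_cSUP_iff[OF _ bdd, of "(SUP F\<in>?F. ?s F) - \<epsilon>\<^sup>2"] ne \<epsilon> by auto
  then obtain F where F: "finite F" "orthonormal F (\<lambda>x. x)" and large: "(SUP F\<in>?F. ?s F) - \<epsilon>\<^sup>2 < ?s F"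
    by auto
  have "norm (A y) \<le> \<epsilon> * norm y" if y: "\<And>f. f \<in> F \<Longrightarrow> cinner f y = 0" for y
  proof (cases "y = 0")
    case False
    define u where "u = (1 / norm y) *\<^sub>C y"
    have u: "norm u = 1" "\<And>f. f \<in> F \<Longrightarrow> cinner f u = 0"
      using False y by (auto simp: u_def norm_divide cinner_algebra)
    then have "u \<notin> F" "orthonormal (insert u F) (\<lambda>x. x)"
      using orthonormal_insert[OF F(2) u] by auto
    then have "?s (insert u F) \<le> (SUP F\<in>?F. ?s F)"
      using F by (intro cSUP_upper[OF _ bdd]) auto
    then have "(norm (A u))\<^sup>2 < \<epsilon>\<^sup>2"
      using large F \<open>u \<notin> F\<close> by simp
    then have "norm (A u) < \<epsilon>"
      using \<epsilon> by (auto intro: power2_less_imp_less[of _ \<epsilon>])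
    moreover have "A u = (1 / norm y) *\<^sub>C A y"
      using bounded_clinear_simps(3)[OF hilbert_schmidt_bounded_clinear[OF A]] by (simp add: u_def)
    ultimately show ?thesis
      using False by (simp add: norm_divide divide_less_eq)
  qed (use bounded_clinear_simps(4)[OF hilbert_schmidt_bounded_clinear[OF A]] in simp)
  with F that show thesis by blast
qed

lemma compact_coefficient_sums:
  assumes "finite F"
  shows "compact {\<Sum>f\<in>F. c f *\<^sub>C g f |c. \<forall>f\<in>F. cmod (c f) \<le> r}" (is "compact (?K F)")
  using assms
proof (induction F)
  case (insert a F)
  have "?K (insert a F) = {x + y |x y. x \<in> (\<lambda>c. c *\<^sub>C g a) ` cball 0 r \<and> y \<in> ?K F}" (is "?L = ?R")
  proof (intro equalityI subsetI)
    fix x assume "x \<in> ?L"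
    then obtain c where c: "x = (\<Sum>f\<in>insert a F. c f *\<^sub>C g f)" "\<forall>f\<in>insert a F. cmod (c f) \<le> r"
      by blast
    then have "x = c a *\<^sub>C g a + (\<Sum>f\<in>F. c f *\<^sub>C g f)" "c a \<in> cball 0 r"
      using insert.hyps by auto
    then show "x \<in> ?R"
      using c by blast
  next
    fix x assume "x \<in> ?R"
    then obtain d c where dc: "x = d *\<^sub>C g a + (\<Sum>f\<in>F. c f *\<^sub>C g f)" "cmod d \<le> r" "\<forall>f\<in>F. cmod (c f) \<le> r"
      by auto
    moreover have "(\<Sum>f\<in>F. c f *\<^sub>C g f) = (\<Sum>f\<in>F. (c(a := d)) f *\<^sub>C g f)"
      using insert.hyps by (intro sum.cong) auto
    ultimately have "x = (\<Sum>f\<in>insert a F. (c(a := d)) f *\<^sub>C g f)"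
      using insert.hyps by simp
    then show "x \<in> ?L"
      using dc by (intro CollectI exI[of _ "c(a := d)"]) auto
  qed
  moreover have "compact ((\<lambda>c. c *\<^sub>C g a) ` cball 0 r)"
    by (intro compact_continuous_image linear_continuous_on bounded_linear_scaleC_left compact_cball)
  ultimately show ?case
    using compact_sums[OF _ insert.IH] by simp
qed simp

text \<open>Up to an arbitrarily small error, the image of a ball lies in a finite-dimensional compact set.\<close>

lemma hilbert_schmidt_compact:
  assumes A: "hilbert_schmidt (A :: 'a::complex_hilbert \<Rightarrow> 'a)" and r: "r > 0"
  shows "compact (closure (A ` cball 0 r))"
  unfolding compact_eq_totally_bounded
proof (intro conjI allI impI)
  show "complete (closure (A ` cball 0 r))"
    by (simp add: complete_eq_closed)
  fix e :: real assume e: "e > 0"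
  note lin = bounded_clinear_simps[OF hilbert_schmidt_bounded_clinear[OF A]]
  have "e / (8 * r) > 0"
    using e r by simp
  then obtain F where F: "finite F" "orthonormal F (\<lambda>x. x)"
    and small: "\<And>y. (\<And>f. f \<in> F \<Longrightarrow> cinner f y = 0) \<Longrightarrow> norm (A y) \<le> e / (8 * r) * norm y"
    using hilbert_schmidt_small_on_complement[OF A] by blast
  let ?K = "{\<Sum>f\<in>F. c f *\<^sub>C A f |c. \<forall>f\<in>F. cmod (c f) \<le> r}"
  have "compact ?K"
    by (rule compact_coefficient_sums[OF F(1)])
  then obtain k where k: "finite k" "?K \<subseteq> (\<Union>x\<in>k. ball x (e/4))"
    using e unfolding compact_eq_totally_bounded by (meson zero_less_divide_iff zero_less_numeral)
  have near: "\<exists>z\<in>k. dist z (A x) < e/2" if x: "norm x \<le> r" for x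
  proof -
    define p where "p = expand F (\<lambda>x. x) (\<lambda>x. x) x"
    have p: "p = (\<Sum>f\<in>F. cinner f x *\<^sub>C f)"
      using F by (simp add: p_def expand_def)
    have "norm (x - p) \<le> 2 * r"
      using norm_triangle_ineq4[of x p] norm_expand_le[OF F(2) F(2), of x] x by (simp add: p_def)
    moreover have "cinner f (x - p) = 0" if "f \<in> F" for f
      using cinner_expand[OF F(2) F(2) that, of x] by (simp add: p_def cinner_diff_right)
    then have "norm (A (x - p)) \<le> e / (8 * r) * norm (x - p)"
      by (rule small)
    ultimately have "norm (A (x - p)) \<le> e / (8 * r) * (2 * r)"
      using e r by (meson divide_nonneg_pos less_eq_real_def mult_left_mono mult_pos_pos order_trans zero_less_numeral)
    then have "norm (A x - A p) \<le> e/4"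
      using r by (simp add: lin)
    moreover have "A p = (\<Sum>f\<in>F. cinner f x *\<^sub>C A f)"
      using bounded_linear.linear[OF bounded_clinear_bounded_linear[OF hilbert_schmidt_bounded_clinear[OF A]]]
      by (simp add: p linear_sum lin)
    have "cmod (cinner f x) \<le> r" if "f \<in> F" for f
      using cauchy_schwarz_cinner[of f x] orthonormal_norm[OF F(2) that] x by simp
    then have "A p \<in> ?K"
      unfolding \<open>A p = _\<close> by (intro CollectI exI[of _ "\<lambda>f. cinner f x"]) auto
    then obtain z where "z \<in> k" "dist z (A p) < e/4"
      using k by auto
    ultimately show ?thesis
      using dist_triangle[of z "A x" "A p"] by (intro bexI[of _ z]) (auto simp: dist_norm norm_minus_commute)
  qed
  have "closure (A ` cball 0 r) \<subseteq> (\<Union>x\<in>k. ball x e)"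
  proof
    fix y assume "y \<in> closure (A ` cball 0 r)"
    then obtain x where x: "norm x \<le> r" "dist (A x) y < e/2"
      using e unfolding closure_approachable by (metis half_gt_zero imageE mem_cball_0)
    then obtain z where "z \<in> k" "dist z (A x) < e/2"
      using near by blast
    then show "y \<in> (\<Union>x\<in>k. ball x e)"
      using x dist_triangle[of z y "A x"] by (intro UN_I[of z]) auto
  qed
  with k show "\<exists>k. finite k \<and> closure (A ` cball 0 r) \<subseteq> (\<Union>x\<in>k. ball x e)"
    by blast
qed

definition selfadjoint :: "('a::complex_hilbert \<Rightarrow> 'a) \<Rightarrow> bool" where
  "selfadjoint T \<longleftrightarrow> (\<forall>x y. cinner (T x) y = cinner x (T y))"

lemma norm_diff_scaleR:
  fixes a x :: "'a::real_inner"
  assumes "norm x = 1"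
  shows "(norm (a - k *\<^sub>R x))\<^sup>2 = (norm a)\<^sup>2 - 2 * k * inner a x + k\<^sup>2"
proof -
  have "inner x x = 1"
    using assms by (simp add: power2_norm_eq_inner[symmetric])
  then show ?thesis
    unfolding power2_norm_eq_inner
    by (simp add: inner_diff_left inner_diff_right inner_commute[of x a] power2_eq_square algebra_simps)
qed

text \<open>
  Let \<open>s\<close> be the norm of \<open>T\<close> on \<open>M\<close>; if it vanishes, every vector will do.  Otherwise,
  for unit vectors \<open>x\<^sub>n\<close> with \<open>\<parallel>T x\<^sub>n\<parallel> \<rightarrow> s\<close> one has
  \<open>T\<^sup>2 x\<^sub>n - s\<^sup>2 x\<^sub>n \<rightarrow> 0\<close>; compactness gives a limit \<open>x\<close> with \<open>T\<^sup>2 x = s\<^sup>2 x\<close>, and then \<open>x\<close> or \<open>T x + s x\<close>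
  is an eigenvector.
\<close>

lemma selfadjoint_hs_eigenvector:
  assumes T: "hilbert_schmidt (T :: 'a::complex_hilbert \<Rightarrow> 'a)" and sa: "selfadjoint T"
    and M: "closed_csubspace M" and inv: "\<And>x. x \<in> M \<Longrightarrow> T x \<in> M" and ne: "x0 \<in> M" "x0 \<noteq> 0"
  shows "\<exists>x\<in>M. norm x = 1 \<and> (\<exists>l::real. T x = complex_of_real l *\<^sub>C x)"
proof -
  note bT = hilbert_schmidt_bounded_clinear[OF T]
  note lin = bounded_clinear_simps[OF bT]
  have sub: "complex_vector.subspace M"
    using M by (simp add: closed_csubspace_def)
  note sc = complex_vector.subspace_scale[OF sub]
  let ?S = "{x\<in>M. norm x = 1}"
  define s where "s = (SUP x\<in>?S. norm (T x))"
  obtain K where K: "\<And>x. norm (T x) \<le> K * norm x"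
    using bounded_clinear_bound[OF bT] by blast
  have bdd: "bdd_above ((\<lambda>x. norm (T x)) ` ?S)"
    by (intro bdd_aboveI[where M = K]) (auto intro: order_trans[OF K])
  have neS: "?S \<noteq> {}"
    using norm_normalize[OF ne(2)] sc[OF ne(1)] by blast
  have le: "norm (T x) \<le> s * norm x" if "x \<in> M" for x
  proof (cases "x = 0")
    case False
    have "norm (T ((1 / norm x) *\<^sub>C x)) \<le> s"
      unfolding s_def using norm_normalize[OF False] sc[OF that] by (intro cSUP_upper[OF _ bdd]) auto
    then show ?thesis
      using False by (simp add: lin norm_divide divide_le_eq)
  qed (simp add: lin)
  have "s \<ge> 0"
    using neS le by (smt (verit, best) all_not_in_conv mem_Collect_eq mult_cancel_left1 norm_ge_zero mult.commute)
  show ?thesis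
  proof (cases "s = 0")
    case True
    obtain x where "x \<in> ?S"
      using neS by blast
    then show ?thesis
      using le[of x] True by (intro bexI[of _ x] conjI exI[of _ 0]) auto
  next
    case False
    with \<open>s \<ge> 0\<close> have s: "s > 0" by simp
    have "\<exists>x\<in>?S. s - 1 / Suc n < norm (T x)" for n
      using less_cSUP_iff[OF neS bdd, of "s - 1 / Suc n"] by (simp add: s_def)
    then obtain X where X: "\<And>n. X n \<in> ?S" "\<And>n. s - 1 / Suc n < norm (T (X n))"
      by metis
    have "seq_compact (closure (T ` cball 0 1))"
      by (intro compact_imp_seq_compact hilbert_schmidt_compact T) simp
    moreover have "\<forall>n. T (X n) \<in> closure (T ` cball 0 1)"
      using X(1) closure_subset[of "T ` cball 0 1"] by force
    ultimately obtain y r where r: "strict_mono r" and "((\<lambda>n. T (X n)) \<circ> r) \<longlonglongrightarrow> y"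
      unfolding seq_compact_def by metis
    then have y: "(\<lambda>n. T (X (r n))) \<longlonglongrightarrow> y"
      by (simp add: o_def)
    have contT: "(\<lambda>n. T (Z n)) \<longlonglongrightarrow> T z" if "Z \<longlonglongrightarrow> z" for Z z
      using bounded_linear.tendsto[OF bounded_clinear_bounded_linear[OF bT] that] .
    define R where "R n = T (T (X (r n))) - s\<^sup>2 *\<^sub>R X (r n)" for n
    have R_le: "(norm (R n))\<^sup>2 \<le> s\<^sup>2 * (s\<^sup>2 - (norm (T (X (r n))))\<^sup>2)" for n
    proof -
      let ?x = "X (r n)"
      have "inner (T (T ?x)) ?x = (norm (T ?x))\<^sup>2"
        using sa unfolding selfadjoint_def inner_eq_Re_cinner by (simp add: cinner_self)
      moreover have "norm ?x = 1" "?x \<in> M"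
        using X by auto
      ultimately have "(norm (R n))\<^sup>2 = (norm (T (T ?x)))\<^sup>2 - 2 * s\<^sup>2 * (norm (T ?x))\<^sup>2 + (s\<^sup>2)\<^sup>2"
        unfolding R_def using norm_diff_scaleR[of ?x "T (T ?x)" "s\<^sup>2"] by simp
      moreover have "(norm (T (T ?x)))\<^sup>2 \<le> s\<^sup>2 * (norm (T ?x))\<^sup>2"
        using power_mono[OF le[OF inv[OF \<open>?x \<in> M\<close>]], of 2] by (simp add: power_mult_distrib)
      ultimately show ?thesis
        by (simp add: algebra_simps power2_eq_square)
    qed
    have "(\<lambda>n. norm (T (X (r n)))) \<longlonglongrightarrow> s"
    proof (rule tendsto_sandwich)
      have "(\<lambda>n. s - 1 / Suc n) \<longlonglongrightarrow> s - 0"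
        by (intro tendsto_diff tendsto_const LIMSEQ_Suc lim_1_over_n)
      from LIMSEQ_subseq_LIMSEQ[OF this r] show "(\<lambda>n. s - 1 / Suc (r n)) \<longlonglongrightarrow> s"
        by (simp add: o_def)
      show "\<forall>\<^sub>F n in sequentially. s - 1 / Suc (r n) \<le> norm (T (X (r n)))"
        by (intro always_eventually allI less_imp_le X(2))
      show "\<forall>\<^sub>F n in sequentially. norm (T (X (r n))) \<le> s"
        using le X(1) by (intro always_eventually) force
    qed auto
    then have "(\<lambda>n. s\<^sup>2 * (s\<^sup>2 - (norm (T (X (r n))))\<^sup>2)) \<longlonglongrightarrow> s\<^sup>2 * (s\<^sup>2 - s\<^sup>2)"
      by (intro tendsto_intros)
    then have "(\<lambda>n. s\<^sup>2 * (s\<^sup>2 - (norm (T (X (r n))))\<^sup>2)) \<longlonglongrightarrow> 0"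
      by simp
    then have "(\<lambda>n. (norm (R n))\<^sup>2) \<longlonglongrightarrow> 0"
      by (rule tendsto_sandwich[OF _ _ tendsto_const, rotated 2]) (auto simp: R_le intro!: always_eventually)
    then have "(\<lambda>n. sqrt ((norm (R n))\<^sup>2)) \<longlonglongrightarrow> sqrt 0"
      by (rule tendsto_real_sqrt)
    then have "(\<lambda>n. norm (R n)) \<longlonglongrightarrow> 0"
      by (simp only: real_sqrt_abs abs_norm_cancel real_sqrt_zero)
    then have R0: "R \<longlonglongrightarrow> 0"
      by (rule tendsto_norm_zero_cancel)
    define x where "x = (1 / s\<^sup>2) *\<^sub>R T y"
    have "X (r n) = (1 / s\<^sup>2) *\<^sub>R (T (T (X (r n))) - R n)" for n
      using s by (simp add: R_def)
    moreover have "(\<lambda>n. (1 / s\<^sup>2) *\<^sub>R (T (T (X (r n))) - R n)) \<longlonglongrightarrow> (1 / s\<^sup>2) *\<^sub>R (T y - 0)"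
      by (intro tendsto_intros contT y R0)
    ultimately have x: "(\<lambda>n. X (r n)) \<longlonglongrightarrow> x"
      by (simp add: x_def)
    have "R \<longlonglongrightarrow> T (T x) - s\<^sup>2 *\<^sub>R x"
      unfolding R_def by (intro tendsto_intros contT x)
    then have "T (T x) - s\<^sup>2 *\<^sub>R x = 0"
      using LIMSEQ_unique R0 by blast
    then have TT: "T (T x) = (s\<^sup>2) *\<^sub>R x"
      by simp
    have "x \<in> M"
      using M X(1) by (intro Lim_in_closed_set[OF _ _ _ x]) (auto simp: closed_csubspace_def)
    have "(\<lambda>n. norm (X (r n))) \<longlonglongrightarrow> norm x"
      by (intro tendsto_norm x)
    moreover have "norm (X (r n)) = 1" for n
      using X(1) by simp
    ultimately have "norm x = 1"
      by (simp add: LIMSEQ_const_iff)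
    define z where "z = T x + s *\<^sub>R x"
    have "z \<in> M"
      unfolding z_def scaleC_of_real[symmetric] using \<open>x \<in> M\<close> inv sc sub by (intro complex_vector.subspace_add) auto
    have Tz: "T z = s *\<^sub>C z"
      unfolding z_def scaleC_of_real[symmetric]
      by (simp add: lin TT scaleC_add_right scaleC_scaleC scaleC_of_real[symmetric] power2_eq_square)
    show ?thesis
    proof (cases "z = 0")
      case True
      then have "T x = - (s *\<^sub>R x)"
        by (simp add: z_def eq_neg_iff_add_eq_0)
      then have "T x = complex_of_real (- s) *\<^sub>C x"
        unfolding scaleC_of_real by simp
      with \<open>x \<in> M\<close> \<open>norm x = 1\<close> show ?thesis by blast
    next
      case False
      have "T ((1 / norm z) *\<^sub>C z) = s *\<^sub>C (1 / norm z) *\<^sub>C z"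
        by (simp add: lin Tz scaleC_scaleC)
      then show ?thesis
        using norm_normalize[OF False] sc[OF \<open>z \<in> M\<close>] by blast
    qed
  qed
qed

lemma cinner_eigenvectors_eq_0:
  assumes "selfadjoint T" "\<And>b. b \<in> B \<Longrightarrow> \<exists>l::real. T b = complex_of_real l *\<^sub>C b"
    and "\<And>b. b \<in> B \<Longrightarrow> cinner b x = 0" "b \<in> B"
  shows "cinner b (T x) = 0"
proof -
  obtain l :: real where "T b = complex_of_real l *\<^sub>C b"
    using assms(2,4) by blast
  then have "cinner (T b) x = 0"
    using assms(3,4) by (simp add: cinner_scaleC_left)
  then show ?thesis
    using assms(1) by (simp add: selfadjoint_def)
qed

text \<open>
  The orthogonal complement of a set of eigenvectors is again invariant; as long as it is nonzero, it
  contains a further eigenvector.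
\<close>

lemma eigenbasis_exists:
  assumes T: "hilbert_schmidt (T :: 'a::complex_hilbert \<Rightarrow> 'a)" and sa: "selfadjoint T"
    and M: "closed_csubspace M" and inv: "\<And>x. x \<in> M \<Longrightarrow> T x \<in> M"
  obtains B where "basis_of M B (\<lambda>x. x)" "\<And>b. b \<in> B \<Longrightarrow> \<exists>l::real. T b = complex_of_real l *\<^sub>C b"
proof -
  let ?C = "{x\<in>M. \<exists>l::real. T x = complex_of_real l *\<^sub>C x}"
  let ?P = "\<lambda>B. \<forall>x\<in>M. (\<forall>b\<in>B. cinner b x = 0) \<longrightarrow> x = 0"
  have "\<exists>B. B \<subseteq> ?C \<and> orthonormal B (\<lambda>x. x) \<and> ?P B"
  proof (rule maximal_orthonormal_set)
    fix B assume B: "B \<subseteq> ?C" "\<not> ?P B"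
    let ?M = "M \<inter> {x. \<forall>b\<in>B. cinner b x = 0}"
    have "T x \<in> ?M" if "x \<in> ?M" for x
      using cinner_eigenvectors_eq_0[OF sa, of B x] inv B that by blast
    moreover obtain x0 where "x0 \<in> ?M" "x0 \<noteq> 0"
      using B by blast
    ultimately obtain x where "x \<in> ?M" "norm x = 1" "\<exists>l::real. T x = complex_of_real l *\<^sub>C x"
      using selfadjoint_hs_eigenvector[OF T sa closed_csubspace_Int[OF M closed_csubspace_orthogonal]] by blast
    then show "\<exists>c\<in>?C. norm c = 1 \<and> (\<forall>b\<in>B. cinner b c = 0)"
      by blast
  qed
  then obtain B where "B \<subseteq> ?C" "orthonormal B (\<lambda>x. x)" "?P B"
    by blast
  then show thesis
    by (intro that[of B]) (auto simp: basis_of_def)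
qed

lemma eigenbasis_cinner:
  assumes "basis_of M B (\<lambda>x. x)" "\<And>b. b \<in> B \<Longrightarrow> \<exists>l::real. T b = complex_of_real l *\<^sub>C b"
    and "b \<in> B" "c \<in> B" "b \<noteq> c"
  shows "cinner b (T c) = 0"
proof -
  obtain l :: real where "T c = complex_of_real l *\<^sub>C c"
    using assms by blast
  then show ?thesis
    using orthonormalD[OF basis_of_orthonormal[OF assms(1)] assms(3,4)] assms(5) by (simp add: cinner_scaleC_right)
qed

section \<open>Conjugations\<close>

lemma conjugation_simps:
  assumes "conjugation J"
  shows "J (x + y) = J x + J y" "J (c *\<^sub>C x) = cnj c *\<^sub>C J x" "cinner (J x) (J y) = cinner y x" "J (J x) = x"
    "J (x - y) = J x - J y" "J 0 = 0" "norm (J x) = norm x" "cinner (J x) y = cinner (J y) x"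
    "cinner x (J y) = cinner y (J x)"
proof -
  show add: "J (x + y) = J x + J y" and sc: "J (c *\<^sub>C x) = cnj c *\<^sub>C J x"
    and ci: "cinner (J x) (J y) = cinner y x" and inv: "J (J x) = x" for x y c
    using assms by (auto simp: conjugation_def)
  have "J (- y) = - J y"
    using sc[of "-1" y] by (simp add: scaleC_minus1)
  then show "J (x - y) = J x - J y"
    using add[of x "- y"] by simp
  show "J 0 = 0"
    using sc[of 0 0] by simp
  show "norm (J x) = norm x"
    by (rule norm_eq_of_cinner_eq) (rule ci)
  show "cinner (J x) y = cinner (J y) x"
    using ci[of x "J y"] inv by simp
  show "cinner x (J y) = cinner y (J x)"
    using ci[of "J x" y] inv by simp
qed

lemma bounded_linear_conjugation:
  assumes "conjugation J"
  shows "bounded_linear J"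
  by (rule bounded_linear_intro[where K = 1])
     (simp_all add: conjugation_simps[OF assms] scaleC_of_real[symmetric])

lemma orthonormal_conjugation:
  "conjugation J \<Longrightarrow> orthonormal I e \<Longrightarrow> orthonormal I (\<lambda>i. J (e i))"
  by (auto simp: orthonormal_def conjugation_simps)

lemma conjugation_expand:
  assumes J: "conjugation J" and "orthonormal I e" "orthonormal I f"
  shows "J (expand I e f x) = expand I (\<lambda>i. J (e i)) (\<lambda>i. J (f i)) (J x)"
proof -
  have "((\<lambda>i. J (cinner (e i) x *\<^sub>C f i)) has_sum J (expand I e f x)) I"
    by (rule has_sum_bounded_linear[OF bounded_linear_conjugation[OF J] has_sum_expand[OF assms(2,3)]])
  moreover have "J (cinner (e i) x *\<^sub>C f i) = cinner (J (e i)) (J x) *\<^sub>C J (f i)" for i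
    using cinner_commute[of x "e i"] by (simp add: conjugation_simps[OF J])
  ultimately show ?thesis
    using has_sum_unique[OF _ has_sum_expand[OF orthonormal_conjugation orthonormal_conjugation]] assms by force
qed

lemma bounded_clinear_conj:
  assumes J: "conjugation J" and A: "bounded_clinear A"
  shows "bounded_clinear (\<lambda>x. J (A (J x)))"
proof -
  obtain K where K: "K \<ge> 0" "\<And>x. norm (A x) \<le> K * norm x"
    using bounded_clinear_bound[OF A] by blast
  have "norm (A (J x)) \<le> K * norm x" for x
    using K(2)[of "J x"] by (simp add: conjugation_simps[OF J])
  then show ?thesis
    by (intro bounded_clinearI[where K = K]) (simp_all add: conjugation_simps[OF J] bounded_clinear_simps[OF A])
qed

lemma hilbert_schmidt_conj:
  assumes J: "conjugation (J :: 'a::complex_hilbert \<Rightarrow> 'a)" and A: "hilbert_schmidt A"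
  shows "hilbert_schmidt (\<lambda>x. J (A (J x)))"
proof -
  obtain E where E: "basis_of UNIV E (\<lambda>x. x :: 'a)"
    using basis_exists[of UNIV] by (auto simp: complex_vector.subspace_UNIV)
  have "(\<lambda>e. (norm (A (J e)))\<^sup>2) summable_on E"
    by (rule hilbert_schmidt_summable[OF A orthonormal_conjugation[OF J basis_of_orthonormal[OF E]]])
  then show ?thesis
    using hilbert_schmidtI[OF bounded_clinear_conj[OF J hilbert_schmidt_bounded_clinear[OF A]] E]
    by (simp add: conjugation_simps[OF J])
qed

text \<open>
  As \<open>T\<close> commutes with \<open>J\<close>, for an eigenvector \<open>x\<close> to a real eigenvalue \<open>x + J x\<close> is an eigenvector fixed by \<open>J\<close>, unless
  \<open>J x = - x\<close>, in which case \<open>\<i> x\<close> is one.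
\<close>

lemma real_eigenbasis_exists:
  assumes J: "conjugation J" and T: "hilbert_schmidt (T :: 'a::complex_hilbert \<Rightarrow> 'a)" and sa: "selfadjoint T"
    and TJ: "\<And>x. T (J x) = J (T x)"
  obtains B where "basis_of UNIV B (\<lambda>x. x)" "\<And>b. b \<in> B \<Longrightarrow> \<exists>l::real. T b = complex_of_real l *\<^sub>C b"
    "\<And>b. b \<in> B \<Longrightarrow> J b = b"
proof -
  note lin = bounded_clinear_simps[OF hilbert_schmidt_bounded_clinear[OF T]]
  note J' = conjugation_simps[OF J]
  let ?C = "{x. J x = x \<and> (\<exists>l::real. T x = complex_of_real l *\<^sub>C x)}"
  let ?P = "\<lambda>B. \<forall>x. (\<forall>b\<in>B. cinner b x = 0) \<longrightarrow> x = 0"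
  have "\<exists>B. B \<subseteq> ?C \<and> orthonormal B (\<lambda>x. x) \<and> ?P B"
  proof (rule maximal_orthonormal_set)
    fix B assume B: "B \<subseteq> ?C" "\<not> ?P B"
    let ?M = "{x. \<forall>b\<in>B. cinner b x = 0}"
    have "T x \<in> ?M" if "x \<in> ?M" for x
      using cinner_eigenvectors_eq_0[OF sa, of B x] B that by blast
    moreover obtain x0 where "x0 \<in> ?M" "x0 \<noteq> 0"
      using B by blast
    ultimately have "\<exists>x\<in>?M. norm x = 1 \<and> (\<exists>l::real. T x = complex_of_real l *\<^sub>C x)"
      by (rule selfadjoint_hs_eigenvector[OF T sa closed_csubspace_orthogonal])
    then obtain x l where x: "x \<in> ?M" "norm x = 1" "T x = complex_of_real l *\<^sub>C x"
      by blast
    have Jx: "J x \<in> ?M"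
    proof -
      have "cinner b (J x) = 0" if "b \<in> B" for b
      proof -
        have "cinner b (J x) = cinner x b"
          using B that J'(9)[of b x] by auto
        then show ?thesis
          using x that cinner_commute[of x b] by simp
      qed
      then show ?thesis by simp
    qed
    define y where "y = (if x + J x = 0 then \<i> *\<^sub>C x else x + J x)"
    have "y \<noteq> 0"
      using x(2) by (auto simp: y_def)
    have "J y = y"
    proof (cases "x + J x = 0")
      case True
      then have "J x = - x"
        by (simp add: eq_neg_iff_add_eq_0 add.commute)
      with True show ?thesis
        by (simp add: y_def J')
    qed (simp add: y_def J' add.commute)
    have "T y = complex_of_real l *\<^sub>C y"
      by (auto simp: y_def lin TJ x J' scaleC_add_right scaleC_scaleC mult.commute)
    have "y \<in> ?M"
      using x Jx by (auto simp: y_def cinner_algebra)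
    let ?c = "(1 / norm y) *\<^sub>C y"
    have "norm ?c = 1"
      by (rule norm_normalize[OF \<open>y \<noteq> 0\<close>])
    moreover have "?c \<in> ?C"
      using \<open>J y = y\<close> \<open>T y = _\<close> by (auto simp: J' lin scaleC_scaleC mult.commute intro!: exI[of _ l])
    moreover have "\<forall>b\<in>B. cinner b ?c = 0"
      using \<open>y \<in> ?M\<close> by (simp add: cinner_scaleC_right)
    ultimately show "\<exists>c\<in>?C. norm c = 1 \<and> (\<forall>b\<in>B. cinner b c = 0)"
      by blast
  qed
  then obtain B where "B \<subseteq> ?C" "orthonormal B (\<lambda>x. x)" "?P B"
    by blast
  then show thesis
    by (intro that[of B]) (auto simp: basis_of_def)
qed

section \<open>Real isometries\<close>

lemma isom_iff:
  assumes "conjugation J"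
  shows "V \<in> isom J \<longleftrightarrow>
    bounded_clinear V \<and> (\<forall>x y. cinner (V x) (V y) = cinner x y) \<and> (\<forall>x. V (J x) = J (V x))"
proof (cases "bounded_clinear V")
  case True
  have "cadjoint V \<circ> V = id \<longleftrightarrow> (\<forall>x y. cinner (V x) (V y) = cinner x y)"
  proof
    assume "cadjoint V \<circ> V = id"
    then have "cadjoint V (V y) = y" for y
      by (metis comp_apply id_apply)
    then show "\<forall>x y. cinner (V x) (V y) = cinner x y"
      using cinner_cadjoint(1)[OF True] by metis
  next
    assume "\<forall>x y. cinner (V x) (V y) = cinner x y"
    then have "cadjoint V (V y) = y" for y
      by (intro cinner_eqI) (simp add: cinner_cadjoint[OF True])
    then show "cadjoint V \<circ> V = id"
      by auto
  qed
  moreover have "conj_op J V = V \<longleftrightarrow> (\<forall>x. V (J x) = J (V x))"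
    using conjugation_simps(4)[OF assms] unfolding conj_op_def fun_eq_iff by metis
  ultimately show ?thesis
    using True by (simp add: isom_def)
qed (simp add: isom_def)

lemma isomD:
  assumes "conjugation J" "V \<in> isom J"
  shows "bounded_clinear V" "cinner (V x) (V y) = cinner x y" "V (J x) = J (V x)"
    "cadjoint V (V x) = x" "cadjoint V (J x) = J (cadjoint V x)"
proof -
  show V: "bounded_clinear V" and ci: "cinner (V x) (V y) = cinner x y" and VJ: "V (J x) = J (V x)" for x y
    using assms isom_iff[OF assms(1)] by auto
  show "cadjoint V (V x) = x"
    by (rule cinner_eqI) (simp add: cinner_cadjoint[OF V] ci)
  show "cadjoint V (J x) = J (cadjoint V x)"
  proof (rule cinner_eqI)
    fix z
    have "cinner z (cadjoint V (J x)) = cinner x (J (V z))"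
      by (simp add: cinner_cadjoint[OF V] conjugation_simps(9)[OF assms(1), of "V z"])
    also have "\<dots> = cinner (cadjoint V x) (J z)"
      by (simp add: cinner_cadjoint[OF V] VJ)
    also have "\<dots> = cinner z (J (cadjoint V x))"
      by (rule conjugation_simps(9)[OF assms(1)])
    finally show "cinner z (cadjoint V (J x)) = cinner z (J (cadjoint V x))" .
  qed
qed

lemma isometry_surjI:
  assumes U: "bounded_clinear U" "\<And>x y. cinner (U x) (U y) = cinner x y"
    and dense: "\<And>z. (\<And>x. cinner (U x) z = 0) \<Longrightarrow> z = 0"
  shows "U (cadjoint U y) = y"
proof -
  have "y - U (cadjoint U y) = 0"
    by (rule dense) (simp add: cinner_diff_right U(2) cinner_cadjoint[OF U(1)])
  then show ?thesis by simp
qed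

text \<open>
  A unit vector \<open>e\<close> orthogonal to the range of an isometry \<open>U\<close> generates the orthonormal sequence
  \<open>e, U e, U\<^sup>2 e, \<dots>\<close> (Wold), whose consecutive terms differ by vectors of norm \<open>\<surd>2\<close>; so the sum of
  \<open>\<parallel>(U - 1) U\<^sup>n e\<parallel>\<^sup>2\<close> diverges.
\<close>

lemma hilbert_schmidt_perturbation_surj:
  assumes U: "bounded_clinear U" "\<And>x y. cinner (U x) (U y) = cinner x y"
    and hs: "hilbert_schmidt (\<lambda>x. U x - x)"
  shows "U (cadjoint U y) = y"
proof (rule isometry_surjI[OF U], rule ccontr)
  fix z assume z: "\<And>x. cinner (U x) z = 0" "z \<noteq> 0"
  define e where "e = (1 / norm z) *\<^sub>C z"
  have e: "norm e = 1" "\<And>x. cinner (U x) e = 0"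
    using norm_normalize[OF z(2)] z(1) by (simp_all add: e_def cinner_scaleC_right)
  have pow: "cinner ((U ^^ n) x) ((U ^^ n) y) = cinner x y" for n x y
    by (induction n) (simp_all add: U(2))
  have less: "cinner ((U ^^ n) e) ((U ^^ m) e) = 0" if "m < n" for m n
  proof -
    obtain k where "n = m + Suc k"
      using \<open>m < n\<close> less_iff_Suc_add by auto
    then have "(U ^^ n) e = (U ^^ m) ((U ^^ Suc k) e)"
      by (simp only: funpow_add comp_apply)
    then show ?thesis
      by (simp add: pow e(2))
  qed
  have on: "orthonormal UNIV (\<lambda>n. (U ^^ n) e)"
    unfolding orthonormal_def
  proof (intro ballI)
    fix m n :: nat
    show "cinner ((U ^^ m) e) ((U ^^ n) e) = (if m = n then 1 else 0)"
      using less[of m n] less[of n m] pow[of m e e] e(1) cinner_commute[of "(U ^^ m) e" "(U ^^ n) e"]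
      by (cases m n rule: linorder_cases) (auto simp: cinner_self)
  qed
  have two: "(norm (U ((U ^^ n) e) - (U ^^ n) e))\<^sup>2 = 2" for n
  proof -
    have "cinner (U ((U ^^ n) e)) (- (U ^^ n) e) = 0"
      using less[of n "Suc n"] by (simp add: cinner_minus_right)
    from norm_add_orthogonal[OF this] show ?thesis
      using orthonormal_norm[OF on, of n] orthonormal_norm[OF on, of "Suc n"] by simp
  qed
  have "(\<lambda>n. (norm (U ((U ^^ n) e) - (U ^^ n) e))\<^sup>2) summable_on UNIV"
    by (rule hilbert_schmidt_summable[OF hs on])
  then have summ: "(\<lambda>n::nat. 2 :: real) summable_on UNIV"
    by (simp only: two)
  obtain n :: nat where "infsum (\<lambda>n::nat. 2 :: real) UNIV < n"
    using reals_Archimedean2 by blast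
  moreover have "(\<Sum>k<n. 2 :: real) \<le> infsum (\<lambda>n::nat. 2 :: real) UNIV"
    by (rule finite_sum_le_infsum[OF summ]) auto
  ultimately show False by simp
qed

lemma isom_cadjoint:
  assumes J: "conjugation J" and U: "U \<in> isom J" "\<And>y. U (cadjoint U y) = y"
  shows "cadjoint U \<in> isom J"
  using assms isomD[OF J U(1)] by (simp add: isom_iff bounded_clinear_cadjoint cinner_cadjoint)

lemma isom_HS_surj:
  assumes J: "conjugation J" and U: "U \<in> isom_HS J"
  shows "U (cadjoint U y) = y"
  using U isomD[OF J] by (intro hilbert_schmidt_perturbation_surj) (auto simp: isom_HS_def)

lemma isom_HS_cadjoint:
  assumes J: "conjugation J" and U: "U \<in> isom_HS J"
  shows "cadjoint U \<in> isom_HS J"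
proof -
  have iU: "U \<in> isom J" and hs: "hilbert_schmidt (\<lambda>f. U f - f)"
    using U by (auto simp: isom_HS_def)
  note bU = isomD(1)[OF J iU]
  have "cadjoint (\<lambda>f. U f - f) = (\<lambda>f. cadjoint U f - f)"
    by (rule cadjointI) (simp add: cinner_algebra cinner_cadjoint[OF bU])
  then show ?thesis
    using hilbert_schmidt_cadjoint[OF hs] isom_cadjoint[OF J iU] isom_HS_surj[OF J U] by (simp add: isom_HS_def)
qed

lemma isom_comp: "conjugation J \<Longrightarrow> U \<in> isom J \<Longrightarrow> V \<in> isom J \<Longrightarrow> U \<circ> V \<in> isom J"
  using bounded_clinear_comp[of U V] by (simp add: isom_iff o_def)

section \<open>Normalizing an orthogonal family\<close>

text \<open>
  The polar decomposition of an operator, carried out on an orthonormal basis whose images are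
  pairwise orthogonal: normalize the images, and replace those that vanish by the vectors \<open>g b\<close>.
\<close>

definition polar_family :: "('a \<Rightarrow> 'a) \<Rightarrow> ('a \<Rightarrow> 'a) \<Rightarrow> 'a \<Rightarrow> 'a::complex_hilbert" where
  "polar_family X g b = (if X b = 0 then g b else (1 / norm (X b)) *\<^sub>C X b)"

lemma orthonormal_polar_family:
  assumes orth: "\<And>b c. b \<in> B \<Longrightarrow> c \<in> B \<Longrightarrow> b \<noteq> c \<Longrightarrow> cinner (X b) (X c) = 0"
    and g: "orthonormal {b\<in>B. X b = 0} g"
    and gX: "\<And>b c. b \<in> B \<Longrightarrow> X b = 0 \<Longrightarrow> c \<in> B \<Longrightarrow> cinner (g b) (X c) = 0"
  shows "orthonormal B (polar_family X g)"
  unfolding orthonormal_def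
proof (intro ballI)
  fix b c assume bc: "b \<in> B" "c \<in> B"
  have Xg: "cinner (X b) (g c) = 0" if "X c = 0"
    using gX[OF bc(2) that bc(1)] cinner_commute[of "X b" "g c"] by simp
  show "cinner (polar_family X g b) (polar_family X g c) = (if b = c then 1 else 0)"
  proof (cases "X b = 0")
    case True
    then show ?thesis
      using bc gX[OF bc(1) True bc(2)] orthonormalD[OF g, of b c]
      by (auto simp: polar_family_def cinner_scaleC_right)
  next
    case False
    then show ?thesis
      using bc Xg orth[OF bc]
      by (auto simp: polar_family_def cinner_algebra cinner_self power2_eq_square)
  qed
qed

text \<open>
  In the applications \<open>t = (1 - X\<^sup>* X) b\<close>, so that the distance \<open>|1 - n|\<close> with \<open>n = \<parallel>X b\<parallel>\<close> is at most
  \<open>|1 - n\<^sup>2| = |\<langle>b, t\<rangle>|\<close>; the vanishing of \<open>X b\<close> does no harm, since then both are \<open>1\<close>.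
\<close>

lemma norm_polar_family_diff_le:
  assumes g: "X b = 0 \<Longrightarrow> norm (g b) = 1" and b: "norm b = 1"
    and X: "cinner (X b) (X b) = 1 - cinner b t"
  shows "norm (polar_family X g b - X b) \<le> norm t"
proof -
  let ?n = "norm (X b)"
  have "norm (polar_family X g b - X b) = \<bar>1 - ?n\<bar>"
  proof (cases "X b = 0")
    case False
    have "polar_family X g b - X b = complex_of_real (1 / ?n - 1) *\<^sub>C X b"
      using False scaleC_of_real[of 1 "X b"]
      by (simp add: polar_family_def complex_vector.scale_left_diff_distrib)
    then have "norm (polar_family X g b - X b) = \<bar>1 / ?n - 1\<bar> * ?n"
      by (simp only: norm_scaleC norm_of_real)
    also have "\<dots> = \<bar>(1 / ?n - 1) * ?n\<bar>"
      by (simp add: abs_mult)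
    also have "(1 / ?n - 1) * ?n = 1 - ?n"
      using False by (simp add: algebra_simps)
    finally show ?thesis .
  qed (use g in \<open>simp add: polar_family_def\<close>)
  also have "\<dots> \<le> \<bar>1 - ?n\<bar> * (1 + ?n)"
    by (simp add: algebra_simps)
  also have "\<dots> = \<bar>(1 - ?n) * (1 + ?n)\<bar>"
    by (simp add: abs_mult)
  also have "(1 - ?n) * (1 + ?n) = 1 - ?n\<^sup>2"
    by (simp add: algebra_simps power2_eq_square)
  also have "complex_of_real (1 - ?n\<^sup>2) = cinner b t"
    using X by (simp add: cinner_self)
  then have "\<bar>1 - ?n\<^sup>2\<bar> = cmod (cinner b t)"
    by (metis norm_of_real)
  also have "\<dots> \<le> norm t"
    using cauchy_schwarz_cinner[of b t] b by simp
  finally show ?thesis .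
qed

lemma expand_cong:
  "(\<And>i. i \<in> I \<Longrightarrow> e i = e' i) \<Longrightarrow> (\<And>i. i \<in> I \<Longrightarrow> f i = f' i) \<Longrightarrow> expand I e f x = expand I e' f' x"
  unfolding expand_def by (intro infsum_cong) simp

lemma cinner_expand_basis:
  assumes "basis_of M I e" "closed_csubspace M" "orthonormal I f" "y \<in> M"
  shows "cinner (expand I e f x) (expand I e f y) = cinner x y"
  using assms basis_of_orthonormal[OF assms(1)]
  by (simp add: cinner_expand_left expand_expand expand_basis)

lemma summable_on_norm_sum:
  fixes a b :: "'i \<Rightarrow> 'a::real_normed_vector"
  assumes "(\<lambda>i. (norm (a i))\<^sup>2) summable_on I" "(\<lambda>i. (norm (b i))\<^sup>2) summable_on I"
    and "\<And>i. i \<in> I \<Longrightarrow> norm (c i) \<le> norm (a i) + norm (b i)"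
  shows "(\<lambda>i. (norm (c i))\<^sup>2) summable_on I"
proof (rule summable_on_comparison_test)
  show "(\<lambda>i. 2 * (norm (a i))\<^sup>2 + 2 * (norm (b i))\<^sup>2) summable_on I"
    using assms by (intro summable_on_add summable_on_cmult_right)
  fix i assume "i \<in> I"
  then have "(norm (c i))\<^sup>2 \<le> (norm (a i) + norm (b i))\<^sup>2"
    using assms(3) by (intro power_mono) auto
  then show "(norm (c i))\<^sup>2 \<le> 2 * (norm (a i))\<^sup>2 + 2 * (norm (b i))\<^sup>2"
    using sum_squares_bound[of "norm (a i)" "norm (b i)"] by (simp add: power2_sum)
qed auto

section \<open>Isometries at Hilbert--Schmidt distance\<close>

text \<open>
  With \<open>E\<^sub>V = 1 - V V\<^sup>*\<close> this is \<open>V W\<^sup>* + E\<^sub>V E\<^sub>W\<close>: it carries \<open>W\<close> to \<open>V\<close> on the range of \<open>W\<close>, and projects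
  \<open>ker W\<^sup>*\<close> to \<open>ker V\<^sup>*\<close>.
\<close>

definition bridge :: "('a \<Rightarrow> 'a) \<Rightarrow> ('a \<Rightarrow> 'a) \<Rightarrow> 'a \<Rightarrow> 'a::complex_hilbert" where
  "bridge V W x = V (cadjoint W x) +
     ((x - W (cadjoint W x)) - V (cadjoint V (x - W (cadjoint W x))))"

lemma bounded_clinear_bridge:
  assumes V: "bounded_clinear V" and W: "bounded_clinear W"
  shows "bounded_clinear (bridge V W)"
proof -
  have WW: "bounded_clinear (\<lambda>x. x - W (cadjoint W x))"
    by (rule bounded_clinear_diff[OF bounded_clinear_id bounded_clinear_comp[OF W bounded_clinear_cadjoint[OF W]]])
  have VV: "bounded_clinear (\<lambda>x. V (cadjoint V x))"
    by (rule bounded_clinear_comp[OF V bounded_clinear_cadjoint[OF V]])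
  have "bounded_clinear (\<lambda>x. V (cadjoint W x) + ((x - W (cadjoint W x)) - V (cadjoint V (x - W (cadjoint W x)))))"
    by (rule bounded_clinear_add[OF bounded_clinear_comp[OF V bounded_clinear_cadjoint[OF W]]
          bounded_clinear_diff[OF WW bounded_clinear_comp[OF VV WW]]])
  then show ?thesis
    unfolding bridge_def[abs_def] .
qed

lemma cinner_bridge:
  assumes V: "bounded_clinear V" and W: "bounded_clinear W"
  shows "cinner (bridge V W x) y = cinner x (bridge W V y)"
  using bounded_clinear_simps[OF V] bounded_clinear_simps[OF W]
    bounded_clinear_simps[OF bounded_clinear_cadjoint[OF V]] bounded_clinear_simps[OF bounded_clinear_cadjoint[OF W]]
  by (simp add: bridge_def cinner_algebra cinner_cadjoint(1)[OF V] cinner_cadjoint(1)[OF W]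
      cinner_cadjoint(2)[OF V, symmetric] cinner_cadjoint(2)[OF W, symmetric])

lemma bridge_range:
  assumes "conjugation J" "W \<in> isom J" "bounded_clinear V"
  shows "bridge V W (W x) = V x"
  using isomD(4)[OF assms(1,2)] bounded_clinear_simps[OF assms(3)]
    bounded_clinear_simps[OF bounded_clinear_cadjoint[OF assms(3)]] by (simp add: bridge_def)

lemma bridge_conj:
  assumes J: "conjugation J" and "V \<in> isom J" "W \<in> isom J"
  shows "bridge V W (J x) = J (bridge V W x)"
  using isomD[OF J assms(2)] isomD[OF J assms(3)]
  by (simp add: bridge_def conjugation_simps(1,5)[OF J, symmetric])

lemma hilbert_schmidt_bridge:
  assumes J: "conjugation J" and V: "V \<in> isom J" and W: "W \<in> isom J"
    and hs: "hilbert_schmidt (\<lambda>x. V x - W x)"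
  shows "hilbert_schmidt (\<lambda>x. bridge V W x - x)"
proof -
  note bV = isomD(1)[OF J V] and bW = isomD(1)[OF J W]
  let ?E = "\<lambda>x. x - W (cadjoint W x)"
  have "cadjoint (\<lambda>x. V x - W x) = (\<lambda>x. cadjoint V x - cadjoint W x)"
    by (rule cadjointI) (simp add: cinner_algebra cinner_cadjoint[OF bV] cinner_cadjoint[OF bW])
  then have hs': "hilbert_schmidt (\<lambda>x. cadjoint V x - cadjoint W x)"
    using hilbert_schmidt_cadjoint[OF hs] by simp
  have E: "bounded_clinear ?E"
    by (rule bounded_clinear_diff[OF bounded_clinear_id bounded_clinear_comp[OF bW bounded_clinear_cadjoint[OF bW]]])
  have "hilbert_schmidt (\<lambda>x. V (cadjoint V (?E x) - cadjoint W (?E x)))"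
    by (rule hilbert_schmidt_comp_left[OF bV hilbert_schmidt_comp_right[OF E hs']])
  moreover have "hilbert_schmidt (\<lambda>x. V (cadjoint W x) - W (cadjoint W x))"
    by (rule hilbert_schmidt_comp_right[OF bounded_clinear_cadjoint[OF bW] hs])
  ultimately have "hilbert_schmidt (\<lambda>x. (V (cadjoint W x) - W (cadjoint W x)) - V (cadjoint V (?E x) - cadjoint W (?E x)))"
    by (rule hilbert_schmidt_diff[rotated])
  moreover have "cadjoint W (?E x) = 0" for x
    by (simp add: bounded_clinear_simps[OF bounded_clinear_cadjoint[OF bW]] isomD(4)[OF J W])
  ultimately show ?thesis
    by (simp add: bridge_def algebra_simps)
qed

definition bridge_defect :: "('a \<Rightarrow> 'a) \<Rightarrow> ('a \<Rightarrow> 'a) \<Rightarrow> 'a \<Rightarrow> 'a::complex_hilbert" where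
  "bridge_defect V W x = x - bridge W V (bridge V W x)"

lemma bridge_defect:
  assumes J: "conjugation J" and V: "V \<in> isom J" and W: "W \<in> isom J"
    and hs: "hilbert_schmidt (\<lambda>x. V x - W x)"
  shows "hilbert_schmidt (bridge_defect V W)" "selfadjoint (bridge_defect V W)"
    "bridge_defect V W (J x) = J (bridge_defect V W x)"
proof -
  note bV = isomD(1)[OF J V] and bW = isomD(1)[OF J W]
  have hs': "hilbert_schmidt (\<lambda>x. W x - V x)"
    using hilbert_schmidt_uminus[OF hs] by simp
  have "hilbert_schmidt (\<lambda>x. - (bridge V W x - x) - (bridge W V (bridge V W x) - bridge V W x))"
    by (rule hilbert_schmidt_diff[OF hilbert_schmidt_uminus[OF hilbert_schmidt_bridge[OF J V W hs]]
          hilbert_schmidt_comp_right[OF bounded_clinear_bridge[OF bV bW] hilbert_schmidt_bridge[OF J W V hs']]])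
  moreover have "(\<lambda>x. - (bridge V W x - x) - (bridge W V (bridge V W x) - bridge V W x)) = bridge_defect V W"
    by (simp add: bridge_defect_def fun_eq_iff)
  ultimately show "hilbert_schmidt (bridge_defect V W)"
    by simp
  show "selfadjoint (bridge_defect V W)"
    by (simp add: selfadjoint_def bridge_defect_def cinner_algebra cinner_bridge[OF bV bW] cinner_bridge[OF bW bV])
  show "bridge_defect V W (J x) = J (bridge_defect V W x)"
    by (simp add: bridge_defect_def bridge_conj[OF J V W] bridge_conj[OF J W V] conjugation_simps[OF J])
qed

definition bridge_basis :: "('a \<Rightarrow> 'a) \<Rightarrow> ('a \<Rightarrow> 'a) \<Rightarrow> ('a \<Rightarrow> 'a) \<Rightarrow> 'a::complex_hilbert set \<Rightarrow> bool" where
  "bridge_basis J V W B \<longleftrightarrow> basis_of UNIV B (\<lambda>x. x) \<and>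
     (\<forall>b\<in>B. J b = b \<and> (\<exists>l::real. bridge_defect V W b = complex_of_real l *\<^sub>C b))"

text \<open>
  The unitary is the polar part of \<open>bridge V W\<close>, completed by \<open>g\<close> on the kernel; on the range of \<open>W\<close>, where
  \<open>bridge V W\<close> is isometric, the polar part agrees with it.
\<close>

lemma intertwiner_of_injection:
  assumes J: "conjugation J" and V: "V \<in> isom J" and W: "W \<in> isom J"
    and hs: "hilbert_schmidt (\<lambda>x. V x - W x)"
    and B: "bridge_basis J V W B" and B': "bridge_basis J W V B'"
    and g: "inj_on g {b\<in>B. bridge V W b = 0}" "g ` {b\<in>B. bridge V W b = 0} \<subseteq> {b\<in>B'. bridge W V b = 0}"
  shows "\<exists>U\<in>isom_HS J. U \<circ> W = V"
proof -
  note bV = isomD(1)[OF J V] and bW = isomD(1)[OF J W]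
  let ?X = "bridge V W" and ?T = "bridge_defect V W"
  let ?f = "polar_family ?X g"
  define U where "U = expand B (\<lambda>x. x) ?f"
  note T = bridge_defect[OF J V W hs]
  have basis: "basis_of UNIV B (\<lambda>x. x)" "basis_of UNIV B' (\<lambda>x. x)"
    and eig: "\<And>b. b \<in> B \<Longrightarrow> \<exists>l::real. ?T b = complex_of_real l *\<^sub>C b"
    and real: "\<And>b. b \<in> B \<Longrightarrow> J b = b" "\<And>b. b \<in> B' \<Longrightarrow> J b = b"
    using B B' by (auto simp: bridge_basis_def)
  note on = basis_of_orthonormal[OF basis(1)] and on' = basis_of_orthonormal[OF basis(2)]
  have XX: "cinner (?X x) (?X y) = cinner x y - cinner x (?T y)" for x y
    by (simp add: bridge_defect_def cinner_bridge[OF bV bW] cinner_algebra)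
  have orth: "cinner (?X b) (?X c) = 0" if "b \<in> B" "c \<in> B" "b \<noteq> c" for b c
    using eigenbasis_cinner[OF basis(1) eig that] orthonormalD[OF on that(1,2)] that(3) by (simp add: XX)
  have "orthonormal (g ` {b\<in>B. ?X b = 0}) (\<lambda>x. x)"
    using g(2) by (intro orthonormal_subset[OF on']) auto
  then have ong: "orthonormal {b\<in>B. ?X b = 0} g"
    by (simp add: orthonormal_image_iff[OF g(1)] o_def)
  have onf: "orthonormal B ?f"
  proof (rule orthonormal_polar_family[OF orth ong])
    fix b c assume "b \<in> B" "?X b = 0"
    then have "bridge W V (g b) = 0"
      using g(2) by auto
    then show "cinner (g b) (?X c) = 0"
      using cinner_bridge[OF bW bV, of "g b" c] by simp
  qed
  have close: "norm (?f b - ?X b) \<le> norm (?T b)" if b: "b \<in> B" for b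
    using b orthonormal_norm[OF ong] orthonormal_norm[OF on] XX[of b b] orthonormalD[OF on b b]
    by (intro norm_polar_family_diff_le) auto
  have bU: "bounded_clinear U"
    unfolding U_def by (rule bounded_clinear_expand[OF on onf])
  have iso: "cinner (U x) (U y) = cinner x y" for x y
    unfolding U_def by (rule cinner_expand_basis[OF basis(1) closed_csubspace_UNIV onf UNIV_I])
  have fJ: "J (?f b) = ?f b" if b: "b \<in> B" for b
  proof -
    have "J (g b) = g b" if "?X b = 0"
      using g(2) b that real(2) by auto
    then show ?thesis
      using bridge_conj[OF J V W, of b] real(1)[OF b] by (simp add: polar_family_def conjugation_simps[OF J])
  qed
  have "U (J x) = J (U x)" for x
    unfolding U_def conjugation_expand[OF J on onf] by (rule expand_cong) (simp_all add: fJ real)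
  with bU iso have "U \<in> isom J"
    by (simp add: isom_iff[OF J])
  moreover have "hilbert_schmidt (\<lambda>x. U x - x)"
  proof (rule hilbert_schmidtI[OF bounded_clinear_diff[OF bU bounded_clinear_id] basis(1)])
    have "norm (U b - b) \<le> norm (?T b) + norm (?X b - b)" if "b \<in> B" for b
      using norm_triangle_ineq[of "?f b - ?X b" "?X b - b"] close[OF that] expand_apply[OF on that, of ?f]
      by (simp add: U_def)
    then show "(\<lambda>b. (norm (U b - b))\<^sup>2) summable_on B"
      by (intro summable_on_norm_sum[OF hilbert_schmidt_summable[OF T(1) on]
            hilbert_schmidt_summable[OF hilbert_schmidt_bridge[OF J V W hs] on]])
  qed
  moreover have "U (W y) = V y" for y
  proof -
    let ?x = "W y"
    have "?X ?x = V y"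
      by (rule bridge_range[OF J W bV])
    then have "?T ?x = 0"
      by (simp add: bridge_defect_def bridge_range[OF J V bW])
    \<comment> \<open>Only basis vectors with \<open>?T b = 0\<close> contribute to \<open>W y\<close>, and on those \<open>?f\<close> and \<open>?X\<close> agree.\<close>
    have "cinner b ?x *\<^sub>C ?f b = ?X (cinner b ?x *\<^sub>C b)" if b: "b \<in> B" for b
    proof (cases "cinner b ?x = 0")
      case False
      obtain l :: real where l: "?T b = complex_of_real l *\<^sub>C b"
        using eig[OF b] by blast
      have "cinner (?T b) ?x = 0"
        using T(2) \<open>?T ?x = 0\<close> by (simp add: selfadjoint_def)
      then have "?T b = 0"
        using False l by (simp add: cinner_scaleC_left)
      then show ?thesis
        using close[OF b] by (simp add: bounded_clinear_simps[OF bounded_clinear_bridge[OF bV bW]])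
    qed (simp add: bounded_clinear_simps[OF bounded_clinear_bridge[OF bV bW]])
    moreover have "((\<lambda>b. ?X (cinner b ?x *\<^sub>C b)) has_sum ?X (expand B (\<lambda>x. x) (\<lambda>x. x) ?x)) B"
      by (rule has_sum_bounded_linear[OF bounded_clinear_bounded_linear[OF bounded_clinear_bridge[OF bV bW]]
            has_sum_expand[OF on on]])
    ultimately have "((\<lambda>b. cinner b ?x *\<^sub>C ?f b) has_sum ?X ?x) B"
      unfolding expand_basis[OF basis(1) closed_csubspace_UNIV UNIV_I] by (simp cong: has_sum_cong)
    then have "U ?x = ?X ?x"
      unfolding U_def expand_def by (rule infsumI)
    then show ?thesis
      using \<open>?X ?x = V y\<close> by simp
  qed
  ultimately show ?thesis
    by (intro bexI[of _ U]) (auto simp: isom_HS_def)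
qed

text \<open>
  The kernels of \<open>bridge V W\<close> and of its adjoint \<open>bridge W V\<close> have bases of which one injects into the
  other; in either case the resulting operator is invertible, which gives the unitary sought.
\<close>

lemma hilbert_schmidt_intertwiner:
  assumes J: "conjugation J" and V: "V \<in> isom J" and W: "W \<in> isom J"
    and hs: "hilbert_schmidt (\<lambda>x. V x - W x)"
  shows "\<exists>U\<in>isom_HS J. U \<circ> W = V"
proof -
  have hs': "hilbert_schmidt (\<lambda>x. W x - V x)"
    using hilbert_schmidt_uminus[OF hs] by simp
  have basis: "\<exists>B. bridge_basis J V W B"
    if V: "V \<in> isom J" and W: "W \<in> isom J" and hs: "hilbert_schmidt (\<lambda>x. V x - W x)" for V W
    using real_eigenbasis_exists[OF J bridge_defect[OF J V W hs]] unfolding bridge_basis_def by metis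
  obtain B B' where B: "bridge_basis J V W B" "bridge_basis J W V B'"
    using basis[OF V W hs] basis[OF W V hs'] by blast
  have "(\<exists>g. inj_on g {b\<in>B. bridge V W b = 0} \<and> g ` {b\<in>B. bridge V W b = 0} \<subseteq> {b\<in>B'. bridge W V b = 0})
      \<or> (\<exists>g. inj_on g {b\<in>B'. bridge W V b = 0} \<and> g ` {b\<in>B'. bridge W V b = 0} \<subseteq> {b\<in>B. bridge V W b = 0})"
    unfolding card_of_ordLeq by (rule ordLeq_total[OF card_of_Well_order card_of_Well_order])
  then consider g where "inj_on g {b\<in>B. bridge V W b = 0}" "g ` {b\<in>B. bridge V W b = 0} \<subseteq> {b\<in>B'. bridge W V b = 0}"
    | g where "inj_on g {b\<in>B'. bridge W V b = 0}" "g ` {b\<in>B'. bridge W V b = 0} \<subseteq> {b\<in>B. bridge V W b = 0}"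
    by blast
  then show ?thesis
  proof cases
    case 1
    then show ?thesis
      by (rule intertwiner_of_injection[OF J V W hs B])
  next
    case 2
    then obtain U where U: "U \<in> isom_HS J" "U \<circ> V = W"
      using intertwiner_of_injection[OF J W V hs' B(2,1)] by blast
    have "cadjoint U (W x) = V x" for x
      using U isomD(4)[OF J, of U] unfolding isom_HS_def by (metis (no_types, lifting) comp_apply mem_Collect_eq)
    then show ?thesis
      using isom_HS_cadjoint[OF J U(1)] by (intro bexI[of _ "cadjoint U"]) auto
  qed
qed

section \<open>Diagonal isometries\<close>

lemma basis_projection_simps:
  assumes J: "conjugation J" and P: "basis_projection J P"
  shows "bounded_clinear P" "P (P x) = P x" "cinner (P x) y = cinner x (P y)" "P (J x) = J x - J (P x)"
proof -
  show bP: "bounded_clinear P" and "P (P x) = P x"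
    using P unfolding basis_projection_def orthogonal_projection_def by (auto simp: fun_eq_iff)
  have "cadjoint P = P"
    using P by (simp add: basis_projection_def orthogonal_projection_def)
  then show "cinner (P x) y = cinner x (P y)"
    using cinner_cadjoint(1)[OF bP] by metis
  have "P (J x) + J (P (J (J x))) = J x"
    using P by (simp add: basis_projection_def conj_op_def)
  then show "P (J x) = J x - J (P x)"
    by (simp add: conjugation_simps[OF J] eq_diff_eq)
qed

definition range1 :: "('a \<Rightarrow> 'a) \<Rightarrow> 'a::complex_hilbert set" where
  "range1 P = {x. P x = x}"

lemma closed_csubspace_range1:
  assumes "bounded_clinear P"
  shows "closed_csubspace (range1 P)"
proof -
  have "closed {x. P x = x}"
    using linear_continuous_on[OF bounded_clinear_bounded_linear[OF assms]]
    by (intro closed_Collect_eq continuous_on_id)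
  then show ?thesis
    by (auto simp: closed_csubspace_def range1_def bounded_clinear_simps[OF assms] intro!: complex_vector.subspaceI)
qed

lemma cinner_range1_conj:
  assumes "conjugation J" "basis_projection J P" "P x = x" "P y = y"
  shows "cinner x (J y) = 0" "cinner (J y) x = 0"
proof -
  note P = basis_projection_simps[OF assms(1,2)]
  have "cinner (P x) (J y) = cinner x (P (J y))"
    by (rule P(3))
  then show "cinner x (J y) = 0"
    using assms by (simp add: P(4) assms(3,4))
  then show "cinner (J y) x = 0"
    using cinner_commute[of "J y" x] by simp
qed

text \<open>
  A subspace invariant under \<open>J\<close> and \<open>P\<close> is the orthogonal sum of its part in the range of \<open>P\<close> and the
  conjugate of that part.
\<close>

lemma doubled_basis:
  assumes J: "conjugation J" and P: "basis_projection J P"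
    and M: "\<And>x. x \<in> M \<Longrightarrow> J x \<in> M" "\<And>x. x \<in> M \<Longrightarrow> P x \<in> M"
    and B: "basis_of (M \<inter> range1 P) B (\<lambda>x. x)"
  shows "B \<inter> J ` B = {}" "basis_of M (B \<union> J ` B) (\<lambda>x. x)"
proof -
  note on = basis_of_orthonormal[OF B]
  note P' = basis_projection_simps[OF J P]
  have BM: "b \<in> M" "P b = b" if "b \<in> B" for b
    using basis_of_in[OF B that] by (auto simp: range1_def)
  have cross: "cinner b (J c) = 0" "cinner (J c) b = 0" if "b \<in> B" "c \<in> B" for b c
    using cinner_range1_conj[OF J P BM(2)[OF that(1)] BM(2)[OF that(2)]] by auto
  show disj: "B \<inter> J ` B = {}"
  proof (rule ccontr)
    assume "B \<inter> J ` B \<noteq> {}"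
    then obtain b c where "b \<in> B" "c \<in> B" "b = J c"
      by blast
    then show False
      using cross(1)[of b c] orthonormalD[OF on, of b b] by simp
  qed
  have "orthonormal (B \<union> J ` B) (\<lambda>x. x)"
    using on cross disj unfolding orthonormal_def
    by (auto simp: conjugation_simps[OF J])
  moreover have "x = 0" if x: "x \<in> M" "\<forall>b\<in>B \<union> J ` B. cinner b x = 0" for x
  proof -
    have "P x = 0"
    proof (rule basis_of_eq_0[OF B])
      show "P x \<in> M \<inter> range1 P"
        using x M by (simp add: range1_def P')
      show "cinner b (P x) = 0" if "b \<in> B" for b
        using x that BM(2)[OF that] by (simp add: P'(3)[symmetric])
    qed
    moreover have "P (J x) = 0"
    proof (rule basis_of_eq_0[OF B])
      show "P (J x) \<in> M \<inter> range1 P"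
        using x M by (simp add: range1_def P'(2))
      show "cinner b (P (J x)) = 0" if "b \<in> B" for b
      proof -
        have "cinner b (P (J x)) = cinner b (J x)"
          using BM(2)[OF that] P'(3)[of b "J x"] by simp
        also have "\<dots> = cnj (cinner (J b) x)"
          using conjugation_simps(9)[OF J, of b x] cinner_commute[of x "J b"] by simp
        finally show ?thesis
          using x that by simp
      qed
    qed
    ultimately have "J x = 0"
      by (simp add: P'(4) conjugation_simps[OF J])
    then show "x = 0"
      using conjugation_simps(4)[OF J, of x] conjugation_simps(6)[OF J] by simp
  qed
  ultimately show "basis_of M (B \<union> J ` B) (\<lambda>x. x)"
    using BM M(1) by (auto simp: basis_of_def)
qed

text \<open>A diagonal real operator is determined by its action \<open>L\<close> on the range of \<open>P\<close>.\<close>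

definition doubled :: "('a \<Rightarrow> 'a) \<Rightarrow> ('a \<Rightarrow> 'a) \<Rightarrow> ('a \<Rightarrow> 'a) \<Rightarrow> 'a \<Rightarrow> 'a::complex_hilbert" where
  "doubled J P L x = L (P x) + J (L (P (J x)))"

lemma doubled_range1:
  assumes "conjugation J" "basis_projection J P" "bounded_clinear L" "P x = x"
  shows "doubled J P L x = L x" "doubled J P L (J x) = J (L x)"
  using assms basis_projection_simps[OF assms(1,2)] bounded_clinear_simps(4)[OF assms(3)]
  by (simp_all add: doubled_def conjugation_simps)

lemma doubled_isom_diag:
  assumes J: "conjugation J" and P: "basis_projection J P" and L: "bounded_clinear L"
    and range: "\<And>x. P x = x \<Longrightarrow> P (L x) = L x"
    and iso: "\<And>x y. P x = x \<Longrightarrow> P y = y \<Longrightarrow> cinner (L x) (L y) = cinner x y"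
  shows "doubled J P L \<in> isom_diag J P"
proof -
  note P' = basis_projection_simps[OF J P] and J' = conjugation_simps[OF J]
  note lin = bounded_clinear_simps[OF L] bounded_clinear_simps[OF P'(1)]
  have LP: "P (L (P x)) = L (P x)" for x
    using range P' by simp
  have bounded: "bounded_clinear (doubled J P L)"
    unfolding doubled_def[abs_def]
    using bounded_clinear_comp[OF L P'(1)]
      bounded_clinear_conj[OF J bounded_clinear_comp[OF L P'(1)]] by (rule bounded_clinear_add)
  have "cinner (doubled J P L x) (doubled J P L y) = cinner x y" for x y
  proof -
    have cross: "cinner (L (P x)) (J (L (P y))) = 0" "cinner (J (L (P x))) (L (P y)) = 0" for x y
      using cinner_range1_conj[OF J P LP LP] by auto
    have "cinner (doubled J P L x) (doubled J P L y) = cinner (P x) (P y) + cinner (P (J y)) (P (J x))"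
      unfolding doubled_def by (simp add: cinner_add_left cinner_add_right cross J'(3) iso P'(2))
    also have "\<dots> = cinner x y"
      by (simp add: P'(2-4) J'(3) cinner_diff_left cinner_diff_right)
    finally show ?thesis .
  qed
  moreover have "doubled J P L (J x) = J (doubled J P L x)" for x
    by (simp add: doubled_def J' add.commute)
  moreover have "P (doubled J P L x) = doubled J P L (P x)" for x
  proof -
    have "P (J (L (P (J x)))) = 0" "P (J (P x)) = 0"
      by (simp_all add: P'(2,4)[of "L _"] P'(4)[of "P _"] LP P'(2))
    then show ?thesis
      by (simp only: doubled_def bounded_clinear_simps(1,4)[OF P'(1)] LP P'(2) bounded_clinear_simps(4)[OF L] J'(6))
  qed
  ultimately show ?thesis
    using bounded by (auto simp: isom_diag_def isom_iff[OF J])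
qed

lemma isom_diagD:
  assumes J: "conjugation J" and P: "basis_projection J P" and W: "W \<in> isom_diag J P"
  shows "W \<in> isom J" "P (W x) = W (P x)" "P (cadjoint W x) = cadjoint W (P x)"
proof -
  note P' = basis_projection_simps[OF J P]
  show iW: "W \<in> isom J" and PW: "P (W x) = W (P x)" for x
    using W by (auto simp: isom_diag_def fun_eq_iff)
  note bW = isomD(1)[OF J iW]
  show "P (cadjoint W x) = cadjoint W (P x)"
  proof (rule cinner_eqI)
    fix z
    have "cinner z (P (cadjoint W x)) = cinner (P z) (cadjoint W x)"
      by (rule P'(3)[symmetric])
    also have "\<dots> = cinner (P (W z)) x"
      unfolding PW by (rule cinner_cadjoint(1)[OF bW])
    also have "\<dots> = cinner (W z) (P x)"
      by (rule P'(3))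
    also have "\<dots> = cinner z (cadjoint W (P x))"
      by (rule cinner_cadjoint(1)[OF bW, symmetric])
    finally show "cinner z (P (cadjoint W x)) = cinner z (cadjoint W (P x))" .
  qed
qed

text \<open>
  Let \<open>A = V\<^sub>2\<^sub>1\<close>, which is Hilbert--Schmidt along with \<open>V\<^sub>1\<^sub>2\<close>, and let \<open>B\<close> be an eigenbasis of \<open>A\<^sup>* A\<close> in the
  range of \<open>P\<close>.  Since \<open>V\<^sub>1\<^sub>1\<^sup>* V\<^sub>1\<^sub>1 = 1 - A\<^sup>* A\<close> there, the vectors \<open>V\<^sub>1\<^sub>1 b\<close> are pairwise orthogonal with
  \<open>1 - \<parallel>V\<^sub>1\<^sub>1 b\<parallel>\<^sup>2 \<le> \<parallel>A\<^sup>* A b\<parallel>\<close>, so normalizing them is a Hilbert--Schmidt perturbation.  If \<open>V\<^sub>1\<^sub>1 b = 0\<close>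
  then \<open>V b\<close> lies in the range of \<open>1 - P\<close>, hence \<open>V (J b) = J (V b)\<close> lies in the range of \<open>P\<close>; these vectors are
  orthogonal to the range of \<open>V\<^sub>1\<^sub>1\<close> and can serve as images of such \<open>b\<close>.
\<close>

lemma isom_P_near_isom_diag:
  assumes J: "conjugation J" and P: "basis_projection J P" and V: "V \<in> isom_P J P"
  shows "\<exists>W\<in>isom_diag J P. hilbert_schmidt (\<lambda>x. V x - W x)"
proof -
  note P' = basis_projection_simps[OF J P] and J' = conjugation_simps[OF J]
  have iV: "V \<in> isom J" and hs12: "hilbert_schmidt (\<lambda>x. P (V (x - P x)))"
    using V by (auto simp: isom_P_def o_def)
  note V' = isomD[OF J iV]
  note lin = bounded_clinear_simps[OF V'(1)] bounded_clinear_simps[OF P'(1)]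
  define A where "A x = V (P x) - P (V (P x))" for x
  have "J (P (V (J x - P (J x)))) = A x" for x
    by (simp add: P'(4) A_def J' V'(3))
  then have hsA: "hilbert_schmidt A"
    using hilbert_schmidt_conj[OF J hs12] by simp
  note bA = hilbert_schmidt_bounded_clinear[OF hsA]
  define T where "T x = cadjoint A (A x)" for x
  have hsT: "hilbert_schmidt T"
    unfolding T_def by (rule hilbert_schmidt_comp_left[OF bounded_clinear_cadjoint[OF bA] hsA])
  have AA: "cinner (A x) (A y) = cinner x (T y)" for x y
    by (simp add: T_def cinner_cadjoint[OF bA])
  then have saT: "selfadjoint T"
    unfolding selfadjoint_def by (metis cinner_commute)
  have PT: "P (T x) = T x" for x
  proof (rule cinner_eqI)
    fix z
    have "A (P z) = A z"
      by (simp add: A_def P'(2))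
    then show "cinner z (P (T x)) = cinner z (T x)"
      by (simp add: P'(3)[symmetric] AA[symmetric])
  qed
  obtain B where B: "basis_of (range1 P) B (\<lambda>x. x)"
    and eig: "\<And>b. b \<in> B \<Longrightarrow> \<exists>l::real. T b = complex_of_real l *\<^sub>C b"
    using eigenbasis_exists[OF hsT saT closed_csubspace_range1[OF P'(1)]] PT
    by (auto simp: range1_def)
  note on = basis_of_orthonormal[OF B]
  have PB: "P b = b" if "b \<in> B" for b
    using basis_of_in[OF B that] by (simp add: range1_def)
  let ?X = "\<lambda>x. P (V x)" and ?g = "\<lambda>b. V (J b)"
  let ?f = "polar_family ?X ?g"
  have XX: "cinner (?X x) (?X y) = cinner x y - cinner x (T y)" if "P x = x" "P y = y" for x y
  proof -
    have "cinner (P (V x)) (V y - P (V y)) = 0"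
      by (simp add: cinner_diff_right P'(3)) (simp add: P'(2) P'(3)[symmetric])
    moreover have "cinner (V x - P (V x)) (P (V y)) = 0"
      by (simp add: cinner_diff_left P'(2,3))
    moreover have "cinner (V x) (V y)
        = cinner (P (V x) + (V x - P (V x))) (P (V y) + (V y - P (V y)))"
      by simp
    ultimately have "cinner (V x) (V y) = cinner (P (V x)) (P (V y)) + cinner (A x) (A y)"
      unfolding cinner_add_left cinner_add_right by (simp add: A_def that)
    then show ?thesis
      by (simp add: V'(2) AA)
  qed
  have orth: "cinner (?X b) (?X c) = 0" if "b \<in> B" "c \<in> B" "b \<noteq> c" for b c
    using eigenbasis_cinner[OF B eig that] orthonormalD[OF on that(1,2)] that(3)
    by (simp add: XX[OF PB[OF that(1)] PB[OF that(2)]])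
  have ong: "orthonormal {b\<in>B. ?X b = 0} ?g"
    using on by (auto simp: orthonormal_def V'(2) J')
  have Pg: "P (?g b) = ?g b" if "?X b = 0" for b
    using that by (simp add: V'(3) P'(4) J')
  have onf: "orthonormal B ?f"
  proof (rule orthonormal_polar_family[OF orth ong])
    fix b c assume "b \<in> B" "?X b = 0" "c \<in> B"
    then have "cinner (?g b) (?X c) = cinner (J b) c"
      using P'(3)[of "?g b" "V c"] by (simp add: Pg V'(2))
    also have "\<dots> = 0"
      by (rule cinner_range1_conj(2)[OF J P PB[OF \<open>c \<in> B\<close>] PB[OF \<open>b \<in> B\<close>]])
    finally show "cinner (?g b) (?X c) = 0" .
  qed
  have close: "norm (?f b - ?X b) \<le> norm (T b)" if b: "b \<in> B" for b
    using b orthonormal_norm[OF ong] orthonormal_norm[OF on] XX[OF PB[OF b] PB[OF b]] orthonormalD[OF on b b]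
    by (intro norm_polar_family_diff_le) auto
  define L where "L = expand B (\<lambda>x. x) ?f"
  have bL: "bounded_clinear L"
    unfolding L_def by (rule bounded_clinear_expand[OF on onf])
  have Pf: "P (?f b) = ?f b" for b
    by (simp add: polar_family_def Pg lin P'(2))
  have W: "doubled J P L \<in> isom_diag J P"
  proof (rule doubled_isom_diag[OF J P bL])
    fix x y assume "P x = x" "P y = y"
    then show "cinner (L x) (L y) = cinner x y"
      unfolding L_def
      by (intro cinner_expand_basis[OF B closed_csubspace_range1[OF P'(1)] onf]) (simp add: range1_def)
    have "L x \<in> range1 P"
      unfolding L_def using Pf
      by (intro expand_in_closed_csubspace[OF on onf closed_csubspace_range1[OF P'(1)]]) (simp add: range1_def)
    then show "P (L x) = L x"
      by (simp add: range1_def)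
  qed
  define H where "H x = P (V (P x)) - L (P x)" for x
  have bH: "bounded_clinear H"
    unfolding H_def[abs_def]
    by (rule bounded_clinear_diff[OF bounded_clinear_comp[OF P'(1) bounded_clinear_comp[OF V'(1) P'(1)]]
          bounded_clinear_comp[OF bL P'(1)]])
  have "hilbert_schmidt H"
  proof (rule hilbert_schmidtI[OF bH])
    have "basis_of (UNIV \<inter> range1 P) B (\<lambda>x. x)"
      using B by simp
    from doubled_basis[OF J P _ _ this]
    show "basis_of UNIV (B \<union> J ` B) (\<lambda>x. x)"
      by auto
    have "norm (H b) \<le> norm (T b)" if "b \<in> B" for b
      using close[OF that] expand_apply[OF on that, of ?f] norm_minus_commute[of "?f b" "?X b"]
      by (simp add: H_def PB[OF that] L_def)
    then have "(\<lambda>b. (norm (H b))\<^sup>2) summable_on B"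
      by (intro summable_on_comparison_test[OF hilbert_schmidt_summable[OF hsT on]]) (auto intro: power_mono)
    moreover have "H x = 0" if "x \<in> J ` B" for x
    proof -
      obtain b where "b \<in> B" "x = J b"
        using \<open>x \<in> J ` B\<close> by blast
      then have "P x = 0"
        by (simp add: P'(4) PB)
      then show ?thesis
        by (simp add: H_def lin bounded_clinear_simps[OF bL])
    qed
    ultimately show "(\<lambda>b. (norm (H b))\<^sup>2) summable_on B \<union> J ` B"
      by (subst summable_on_cong_neutral[where T = B and g = "\<lambda>b. (norm (H b))\<^sup>2"]) auto
  qed
  then have HA: "hilbert_schmidt (\<lambda>x. H x + A x)"
    by (rule hilbert_schmidt_add[OF _ hsA])
  have "V x - doubled J P L x = (H x + A x) + J (H (J x) + A (J x))" for x
  proof -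
    have "V x = V (P x) + J (V (P (J x)))"
      by (simp add: V'(3)[symmetric] P'(4) J' lin)
    then show ?thesis
      by (simp add: doubled_def H_def A_def J')
  qed
  then have "hilbert_schmidt (\<lambda>x. V x - doubled J P L x)"
    using hilbert_schmidt_add[OF HA hilbert_schmidt_conj[OF J HA]] by simp
  with W show ?thesis by blast
qed

section \<open>Factorization\<close>

text \<open>\<open>(U V)\<^sub>1\<^sub>2 = U\<^sub>1\<^sub>1 V\<^sub>1\<^sub>2 + U\<^sub>1\<^sub>2 V\<^sub>2\<^sub>2\<close>.\<close>

lemma isom_P_comp:
  assumes J: "conjugation J" and P: "basis_projection J P" and U: "U \<in> isom_P J P" and V: "V \<in> isom_P J P"
  shows "U \<circ> V \<in> isom_P J P"
proof -
  note P' = basis_projection_simps[OF J P]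
  have iU: "U \<in> isom J" and hsU: "hilbert_schmidt (\<lambda>x. P (U (x - P x)))"
    and iV: "V \<in> isom J" and hsV: "hilbert_schmidt (\<lambda>x. P (V (x - P x)))"
    using U V by (auto simp: isom_P_def o_def)
  note bU = isomD(1)[OF J iU] and bV = isomD(1)[OF J iV]
  have Q: "bounded_clinear (\<lambda>x. x - P x)"
    by (rule bounded_clinear_diff[OF bounded_clinear_id P'(1)])
  have "hilbert_schmidt (\<lambda>x. P (U (P (V (x - P x)))) + P (U (V (x - P x) - P (V (x - P x)))))"
    by (rule hilbert_schmidt_add[OF hilbert_schmidt_comp_left[OF bounded_clinear_comp[OF P'(1) bU] hsV]
          hilbert_schmidt_comp_right[OF bounded_clinear_comp[OF bV Q] hsU]])
  then have "hilbert_schmidt (\<lambda>x. P (U (V (x - P x))))"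
    by (simp add: bounded_clinear_simps[OF P'(1)] bounded_clinear_simps[OF bU])
  then show ?thesis
    using isom_comp[OF J iU iV] by (simp add: isom_P_def o_def)
qed

lemma isom_HS_subset_isom_P:
  assumes J: "conjugation J" and P: "basis_projection J P"
  shows "isom_HS J \<subseteq> isom_P J P"
proof
  fix U assume "U \<in> isom_HS J"
  then have U: "U \<in> isom J" and hs: "hilbert_schmidt (\<lambda>x. U x - x)"
    by (auto simp: isom_HS_def)
  note P' = basis_projection_simps[OF J P]
  have "hilbert_schmidt (\<lambda>x. P (U (x - P x) - (x - P x)))"
    by (rule hilbert_schmidt_comp_left[OF P'(1)
          hilbert_schmidt_comp_right[OF bounded_clinear_diff[OF bounded_clinear_id P'(1)] hs]])
  then show "U \<in> isom_P J P"
    using U by (simp add: isom_P_def o_def bounded_clinear_simps[OF P'(1)] P'(2))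
qed

lemma isom_diag_subset_isom_P:
  assumes J: "conjugation J" and P: "basis_projection J P"
  shows "isom_diag J P \<subseteq> isom_P J P"
proof
  fix W assume W: "W \<in> isom_diag J P"
  note W' = isom_diagD[OF J P W] and P' = basis_projection_simps[OF J P]
  have "P \<circ> W \<circ> (\<lambda>x. x - P x) = (\<lambda>x. 0)"
    by (auto simp: fun_eq_iff W'(2) bounded_clinear_simps[OF P'(1)] P'(2)
        bounded_clinear_simps(4)[OF isomD(1)[OF J W'(1)]])
  moreover have "hilbert_schmidt (\<lambda>x::'a. 0)"
    unfolding hilbert_schmidt_iff hs_bounded_def using bounded_clinear_zero by auto
  ultimately show "W \<in> isom_P J P"
    using W'(1) by (simp add: isom_P_def)
qed

lemma isom_P_factorization:
  assumes J: "conjugation J" and P: "basis_projection J P"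
  shows "isom_P J P = {U \<circ> W | U W. U \<in> isom_HS J \<and> W \<in> isom_diag J P}"
proof (intro equalityI subsetI)
  fix V assume V: "V \<in> isom_P J P"
  then have iV: "V \<in> isom J"
    by (simp add: isom_P_def)
  obtain W where W: "W \<in> isom_diag J P" "hilbert_schmidt (\<lambda>x. V x - W x)"
    using isom_P_near_isom_diag[OF J P V] by blast
  then obtain U where "U \<in> isom_HS J" "U \<circ> W = V"
    using hilbert_schmidt_intertwiner[OF J iV isom_diagD(1)[OF J P]] by blast
  with W show "V \<in> {U \<circ> W | U W. U \<in> isom_HS J \<and> W \<in> isom_diag J P}"
    by blast
next
  fix V assume "V \<in> {U \<circ> W | U W. U \<in> isom_HS J \<and> W \<in> isom_diag J P}"
  then show "V \<in> isom_P J P"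
    using isom_P_comp[OF J P] isom_HS_subset_isom_P[OF J P] isom_diag_subset_isom_P[OF J P] by blast
qed

section \<open>Dimensions\<close>

definition ecard :: "'a set \<Rightarrow> enat" where
  "ecard B = (if finite B then enat (card B) else \<infinity>)"

lemma ecard_image: "inj_on f B \<Longrightarrow> ecard (f ` B) = ecard B"
  by (simp add: ecard_def finite_image_iff card_image)

lemma independent_orthonormal:
  assumes "orthonormal B (\<lambda>x. x)"
  shows "complex_vector.independent (B :: 'a::complex_hilbert set)"
proof
  assume "complex_vector.dependent B"
  then obtain F u b where F: "finite F" "F \<subseteq> B" "(\<Sum>v\<in>F. u v *\<^sub>C v) = 0" "b \<in> F" "u b \<noteq> 0"
    unfolding complex_vector.dependent_explicit by blast
  have "cinner b (\<Sum>v\<in>F. u v *\<^sub>C v) = (\<Sum>v\<in>F. if b = v then u v else 0)"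
    unfolding cinner_sum_right using F orthonormalD[OF orthonormal_subset[OF assms F(2)]]
    by (intro sum.cong) (auto simp: cinner_scaleC_right)
  then show False
    using F by simp
qed

lemma cdimension_basis:
  assumes M: "complex_vector.subspace M" and B: "basis_of M B (\<lambda>x. x)"
  shows "cdimension M = ecard B"
proof (cases "finite B")
  case True
  note on = basis_of_orthonormal[OF B]
  have BM: "B \<subseteq> M"
    using basis_of_in[OF B] by blast
  have span: "x \<in> complex_vector.span B" if "x \<in> M" for x
  proof -
    have eq: "expand B (\<lambda>x. x) (\<lambda>x. x) x = (\<Sum>b\<in>B. cinner b x *\<^sub>C b)"
      using True by (simp add: expand_def)
    have "(\<Sum>b\<in>B. cinner b x *\<^sub>C b) \<in> M"
      using BM by (intro complex_vector.subspace_sum[OF M] complex_vector.subspace_scale[OF M]) auto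
    then have "x - expand B (\<lambda>x. x) (\<lambda>x. x) x \<in> M"
      unfolding eq by (rule complex_vector.subspace_diff[OF M that])
    then have "x - expand B (\<lambda>x. x) (\<lambda>x. x) x = 0"
      by (rule basis_of_eq_0[OF B]) (simp add: cinner_diff_right cinner_expand[OF on on])
    then have "x = (\<Sum>b\<in>B. cinner b x *\<^sub>C b)"
      by (simp add: eq)
    also have "\<dots> \<in> complex_vector.span B"
      by (intro complex_vector.span_sum complex_vector.span_scale complex_vector.span_base)
    finally show ?thesis .
  qed
  then have "M \<subseteq> complex_vector.span B"
    by blast
  moreover from this have "card B = complex_vector.dim M"
    by (rule complex_vector.basis_card_eq_dim[OF BM _ independent_orthonormal[OF on]])
  ultimately show ?thesis
    using True by (auto simp: cdimension_def ecard_def)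
next
  case False
  have "\<not> M \<subseteq> complex_vector.span F" if "finite F" for F
  proof
    assume "M \<subseteq> complex_vector.span F"
    then have "B \<subseteq> complex_vector.span F"
      using basis_of_in[OF B] by blast
    then show False
      using complex_vector.independent_span_bound[OF that independent_orthonormal[OF basis_of_orthonormal[OF B]]] False
      by blast
  qed
  then show ?thesis
    using False by (auto simp: cdimension_def ecard_def)
qed

text \<open>The balls of radius \<open>1/2\<close> around the vectors of an orthonormal set are pairwise disjoint.\<close>

lemma countable_orthonormal:
  assumes sep: "separable_space (euclidean :: 'a::complex_hilbert topology)"
    and B: "orthonormal (B :: 'a set) (\<lambda>x. x)"
  shows "countable B"
proof -
  obtain C :: "'a set" where C: "countable C" "closure C = UNIV"
    using sep by (auto simp: separable_space_def)
  have "\<exists>c\<in>C. dist c b < 1/2" for b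
    using C(2) closure_approachable[of b C] by (metis UNIV_I half_gt_zero zero_less_one)
  then obtain h where h: "\<And>b. h b \<in> C" "\<And>b. dist (h b) b < 1/2"
    by metis
  have "inj_on h B"
  proof (rule inj_onI, rule ccontr)
    fix b c assume bc: "b \<in> B" "c \<in> B" "h b = h c" "b \<noteq> c"
    have "dist b c < 1"
      using dist_triangle_half_r[of "h b" b 1 c] h(2)[of b] h(2)[of c] bc(3) by (simp add: dist_commute)
    moreover have "(norm (b - c))\<^sup>2 = 2"
      using norm_add_orthogonal[of b "- c"] orthonormalD[OF B bc(1,2)] orthonormal_norm[OF B] bc
      by (simp add: cinner_minus_right)
    ultimately show False
      using power_strict_mono[of "norm (b - c)" 1 2] by (simp add: dist_norm)
  qed
  moreover have "countable (h ` B)"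
    using C(1) h(1) by (meson countable_subset image_subsetI)
  ultimately show ?thesis
    using countable_image_inj_on by blast
qed

lemma bij_betw_of_ecard_eq:
  assumes "countable A" "countable B" "ecard A = ecard B"
  obtains h where "bij_betw h A B"
proof (cases "finite A")
  case True
  then show thesis
    using assms that finite_same_card_bij[of A B] by (auto simp: ecard_def split: if_splits)
next
  case False
  then have "infinite B"
    using assms(3) by (auto simp: ecard_def split: if_splits)
  then show thesis
    using that False assms to_nat_on_infinite[of A] bij_betw_from_nat_into[of B] bij_betw_trans by blast
qed

section \<open>The index\<close>

definition coker :: "('a \<Rightarrow> 'a) \<Rightarrow> 'a::complex_hilbert set" where
  "coker V = {x. cadjoint V x = 0}"

lemma closed_csubspace_coker:
  assumes "bounded_clinear V"
  shows "closed_csubspace (coker V)"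
proof -
  have "coker V = {x. \<forall>b\<in>range V. cinner b x = 0}"
    unfolding coker_def using cinner_cadjoint(1)[OF assms] cinner_self_eq_0[of "cadjoint V _"]
    by (auto simp flip: cinner_cadjoint(1)[OF assms]) (metis cinner_self_eq_0)
  then show ?thesis
    by (simp only: closed_csubspace_orthogonal)
qed

lemma neg_ind_basis:
  assumes "bounded_clinear V" "basis_of (coker V) B (\<lambda>x. x)"
  shows "neg_ind V = ecard B"
  using cdimension_basis[OF _ assms(2)] closed_csubspace_coker[OF assms(1)]
  by (simp add: neg_ind_def coker_def closed_csubspace_def)

lemma neg_ind_comp_unitary:
  assumes J: "conjugation J" and U: "U \<in> isom J" "\<And>y. U (cadjoint U y) = y" and V: "V \<in> isom J"
  shows "neg_ind (U \<circ> V) = neg_ind V"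
proof -
  note bU = isomD(1)[OF J U(1)] and bV = isomD(1)[OF J V]
  have bUV: "bounded_clinear (U \<circ> V)"
    using bounded_clinear_comp[OF bU bV] by (simp add: o_def)
  obtain B where B: "basis_of (coker V) B (\<lambda>x. x)"
    using basis_exists[of "coker V"] closed_csubspace_coker[OF bV] by (auto simp: closed_csubspace_def)
  have coker: "x \<in> coker (U \<circ> V) \<longleftrightarrow> cadjoint U x \<in> coker V" for x
    using cadjoint_comp[OF bU bV] by (simp add: coker_def o_def)
  have "basis_of (coker (U \<circ> V)) B U"
    unfolding basis_of_def
  proof (intro conjI ballI impI)
    show "orthonormal B U"
      using basis_of_orthonormal[OF B] by (simp add: orthonormal_def isomD(2)[OF J U(1)])
    show "U ` B \<subseteq> coker (U \<circ> V)"
      using basis_of_in[OF B] by (auto simp: coker isomD(4)[OF J U(1)])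
    fix x assume "x \<in> coker (U \<circ> V)" "\<forall>b\<in>B. cinner (U b) x = 0"
    then have "cadjoint U x = 0"
      by (intro basis_of_eq_0[OF B]) (simp_all add: coker cinner_cadjoint[OF bU])
    then show "x = 0"
      using U(2)[of x] bounded_clinear_simps(4)[OF bU] by simp
  qed
  then have "neg_ind (U \<circ> V) = ecard (U ` B)" "inj_on U B"
    using neg_ind_basis[OF bUV basis_of_image] orthonormal_inj[OF basis_of_orthonormal] by blast+
  then show ?thesis
    using neg_ind_basis[OF bV B] by (simp add: ecard_image)
qed

text \<open>The cokernel of a diagonal isometry is \<open>J\<close>-invariant and splits along \<open>P\<close>, so its dimension is even.\<close>

lemma coker_diag_doubled_basis:
  assumes J: "conjugation J" and P: "basis_projection J P" and W: "W \<in> isom_diag J P"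
    and B: "basis_of (coker W \<inter> range1 P) B (\<lambda>x. x)"
  shows "B \<inter> J ` B = {}" "basis_of (coker W) (B \<union> J ` B) (\<lambda>x. x)"
proof -
  note W' = isom_diagD[OF J P W] and P' = basis_projection_simps[OF J P]
  have "J x \<in> coker W" "P x \<in> coker W" if "x \<in> coker W" for x
    using that isomD(5)[OF J W'(1)] conjugation_simps(6)[OF J] bounded_clinear_simps(4)[OF P'(1)]
    by (simp_all add: coker_def W'(3)[symmetric])
  then show "B \<inter> J ` B = {}" "basis_of (coker W) (B \<union> J ` B) (\<lambda>x. x)"
    using doubled_basis[OF J P _ _ B] by auto
qed

lemma ecard_doubled:
  assumes "conjugation J" "B \<inter> J ` B = {}"
  shows "ecard (B \<union> J ` B) = 2 * ecard B"
proof -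
  have "inj_on J B"
    by (rule inj_onI) (metis conjugation_simps(4)[OF assms(1)])
  then show ?thesis
    using assms(2) card_Un_disjoint[of B "J ` B"]
    by (auto simp: ecard_def card_image finite_image_iff numeral_eq_enat)
qed

lemma neg_ind_diag:
  assumes J: "conjugation J" and P: "basis_projection J P" and W: "W \<in> isom_diag J P"
    and B: "basis_of (coker W \<inter> range1 P) B (\<lambda>x. x)"
  shows "neg_ind W = 2 * ecard B"
  using coker_diag_doubled_basis[OF assms] neg_ind_basis[OF isomD(1)[OF J isom_diagD(1)[OF J P W]]]
    ecard_doubled[OF J] by metis

lemma coker_diag_basis_exists:
  assumes J: "conjugation J" and P: "basis_projection J P" and W: "W \<in> isom_diag J P"
  obtains B where "basis_of (coker W \<inter> range1 P) B (\<lambda>x. x)"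
proof -
  have "closed_csubspace (coker W \<inter> range1 P)"
    using isomD(1)[OF J isom_diagD(1)[OF J P W]] basis_projection_simps(1)[OF J P]
    by (intro closed_csubspace_Int closed_csubspace_coker closed_csubspace_range1)
  then show thesis
    using basis_exists[of "coker W \<inter> range1 P"] that by (auto simp: closed_csubspace_def)
qed

lemma enat_double_inject: "2 * m = 2 * n \<Longrightarrow> m = (n :: enat)"
  by (cases m; cases n) (auto simp: numeral_eq_enat)

text \<open>
  On the range of \<open>P\<close> the unitary is \<open>W' W\<^sup>*\<close> plus a bijection between orthonormal bases of the two
  cokernels.
\<close>

lemma diag_intertwiner:
  assumes sep: "separable_space (euclidean :: 'a::complex_hilbert topology)"
    and J: "conjugation (J :: 'a \<Rightarrow> 'a)" and P: "basis_projection J P"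
    and W: "W \<in> isom_diag J P" and W': "W' \<in> isom_diag J P" and ind: "neg_ind W = neg_ind W'"
  shows "\<exists>Y\<in>isom_diag J P. (\<forall>y. Y (cadjoint Y y) = y) \<and> Y \<circ> W = W'"
proof -
  note P' = basis_projection_simps[OF J P] and J' = conjugation_simps[OF J]
  note dW = isom_diagD[OF J P W] and dW' = isom_diagD[OF J P W']
  note iW = isomD[OF J dW(1)] and iW' = isomD[OF J dW'(1)]
  note cW = bounded_clinear_simps[OF bounded_clinear_cadjoint[OF iW(1)]]
  obtain B where B: "basis_of (coker W \<inter> range1 P) B (\<lambda>x. x)"
    using coker_diag_basis_exists[OF J P W] .
  obtain B' where B': "basis_of (coker W' \<inter> range1 P) B' (\<lambda>x. x)"
    using coker_diag_basis_exists[OF J P W'] .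
  note on = basis_of_orthonormal[OF B] and on' = basis_of_orthonormal[OF B']
  have "ecard B = ecard B'"
    using ind unfolding neg_ind_diag[OF J P W B] neg_ind_diag[OF J P W' B'] by (rule enat_double_inject)
  then obtain h where h: "bij_betw h B B'"
    using bij_betw_of_ecard_eq[OF countable_orthonormal[OF sep on] countable_orthonormal[OF sep on']] by blast
  have onh: "orthonormal B h"
    using on' h orthonormal_image_iff[of h B "\<lambda>x. x"] by (simp add: bij_betw_def o_def)
  have hB: "cadjoint W' (h b) = 0" "P (h b) = h b" if "b \<in> B" for b
    using basis_of_in[OF B', of "h b"] h that by (auto simp: bij_betw_def coker_def range1_def)
  have bB: "cadjoint W b = 0" "P b = b" if "b \<in> B" for b
    using basis_of_in[OF B that] by (auto simp: coker_def range1_def)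
  have M: "closed_csubspace (coker W \<inter> range1 P)" "closed_csubspace (coker W' \<inter> range1 P)"
    using iW(1) iW'(1) P'(1)
    by (intro closed_csubspace_Int closed_csubspace_coker closed_csubspace_range1; simp)+
  define Z where "Z = expand B (\<lambda>x. x) h"
  have bZ: "bounded_clinear Z"
    unfolding Z_def by (rule bounded_clinear_expand[OF on onh])
  have ZM: "cadjoint W' (Z x) = 0" "P (Z x) = Z x" for x
    using expand_in_closed_csubspace[OF on onh M(2), of x] hB
    by (simp_all add: Z_def coker_def range1_def)
  have ZW: "Z (W x) = 0" for x
  proof -
    have "cinner b (W x) = cnj (cinner x (cadjoint W b))" for b
      using cinner_commute[of b "W x"] by (simp add: cinner_cadjoint[OF iW(1)])
    then show ?thesis
      unfolding Z_def by (intro expand_eq_0) (simp add: bB)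
  qed
  \<comment> \<open>On the range of \<open>P\<close>, the initial projection of \<open>Z\<close> is \<open>1 - W W\<^sup>*\<close>.\<close>
  have ZZ: "cinner (Z x) (Z y) = cinner x y - cinner (cadjoint W x) (cadjoint W y)" if "P y = y" for x y
  proof -
    let ?y = "y - W (cadjoint W y)"
    have "?y \<in> coker W \<inter> range1 P"
      using that by (simp add: coker_def range1_def cW iW(4) bounded_clinear_simps[OF P'(1)] dW)
    then have "expand B (\<lambda>x. x) (\<lambda>x. x) ?y = ?y"
      by (rule expand_basis[OF B M(1)])
    moreover have "Z y = Z ?y"
      by (simp add: bounded_clinear_simps[OF bZ] ZW)
    ultimately have "cinner (Z x) (Z y) = cinner x ?y"
      unfolding Z_def using cinner_expand_left[OF on onh] expand_expand[OF on onh] by metis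
    then show ?thesis
      using cinner_cadjoint(2)[OF iW(1), of x "cadjoint W y"] by (simp add: cinner_diff_right)
  qed
  define L where "L x = W' (cadjoint W x) + Z x" for x
  have bL: "bounded_clinear L"
    unfolding L_def[abs_def]
    by (rule bounded_clinear_add[OF bounded_clinear_comp[OF iW'(1) bounded_clinear_cadjoint[OF iW(1)]] bZ])
  define Y where "Y = doubled J P L"
  have Y: "Y \<in> isom_diag J P"
    unfolding Y_def
  proof (rule doubled_isom_diag[OF J P bL])
    fix x y assume xy: "P x = x" "P y = y"
    show "P (L x) = L x"
      by (simp add: L_def bounded_clinear_simps[OF P'(1)] dW dW' ZM xy)
    have "cinner (W' u) (Z v) = 0" "cinner (Z v) (W' u) = 0" for u v
      using cinner_cadjoint[OF iW'(1), of u "Z v"] cinner_commute[of "Z v" "W' u"] by (simp_all add: ZM)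
    then show "cinner (L x) (L y) = cinner x y"
      by (simp add: L_def cinner_add_left cinner_add_right iW'(2) ZZ[OF xy(2)])
  qed
  note dY = isom_diagD[OF J P Y]
  note iY = isomD[OF J dY(1)]
  have YW: "Y (W x) = W' x" for x
  proof -
    have "Y (W x) = W' (P x) + J (W' (P (J x)))"
      by (simp add: Y_def doubled_def iW(3)[symmetric] dW(2)) (simp add: L_def iW(4) ZW)
    also have "\<dots> = W' (P x) + W' (x - P x)"
      by (simp add: iW'(3)[symmetric] P'(4) J')
    finally show ?thesis
      by (simp add: bounded_clinear_simps[OF iW'(1)])
  qed
  have Yb: "Y b = h b" "Y (J b) = J (h b)" if b: "b \<in> B" for b
  proof -
    have "L b = h b"
      using expand_apply[OF on b, of h] by (simp add: L_def Z_def bB[OF b] bounded_clinear_simps[OF iW'(1)])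
    then show "Y b = h b" "Y (J b) = J (h b)"
      using doubled_range1[OF J P bL bB(2)[OF b]] by (simp_all add: Y_def)
  qed
  have "z = 0" if z: "\<And>x. cinner (Y x) z = 0" for z
  proof (rule basis_of_eq_0[OF coker_diag_doubled_basis(2)[OF J P W' B']])
    have "cinner (cadjoint W' z) (cadjoint W' z) = 0"
      using z[of "W (cadjoint W' z)"] by (simp add: YW cinner_cadjoint[OF iW'(1)])
    then show "z \<in> coker W'"
      by (simp add: coker_def)
    fix c assume "c \<in> B' \<union> J ` B'"
    then obtain b where "b \<in> B" "c = h b \<or> c = J (h b)"
      using h by (auto simp: bij_betw_def)
    then show "cinner c z = 0"
      using z[of b] z[of "J b"] Yb[of b] by auto
  qed
  then have "Y (cadjoint Y y) = y" for y
    by (rule isometry_surjI[OF iY(1,2)])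
  with Y YW show ?thesis
    by (intro bexI[of _ Y]) auto
qed

text \<open>
  Shifts of an orthonormal basis of the range of \<open>P\<close>: \<open>e k \<mapsto> e (k + n)\<close> for finite \<open>n\<close>, and
  \<open>e k \<mapsto> e (2 k)\<close> for infinite index.
\<close>

lemma diag_isometry_exists:
  assumes sep: "separable_space (euclidean :: 'a::complex_hilbert topology)"
    and inf: "cdimension (UNIV :: 'a set) = \<infinity>"
    and J: "conjugation (J :: 'a \<Rightarrow> 'a)" and P: "basis_projection J P"
  shows "\<exists>W\<in>isom_diag J P. neg_ind W = 2 * m"
proof -
  note P' = basis_projection_simps[OF J P]
  note M = closed_csubspace_range1[OF P'(1)]
  obtain B where B: "basis_of (range1 P) B (\<lambda>x. x)"
    using basis_exists[of "range1 P"] M by (auto simp: closed_csubspace_def)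
  have "basis_of (UNIV \<inter> range1 P) B (\<lambda>x. x)"
    using B by simp
  then have "basis_of UNIV (B \<union> J ` B) (\<lambda>x. x)"
    using doubled_basis(2)[OF J P] by blast
  then have "ecard (B \<union> J ` B) = \<infinity>"
    using cdimension_basis[OF complex_vector.subspace_UNIV] inf by metis
  then have "infinite B"
    by (auto simp: ecard_def split: if_splits)
  then have e: "bij_betw (from_nat_into B) UNIV B"
    by (intro bij_betw_from_nat_into countable_orthonormal[OF sep basis_of_orthonormal[OF B]])
  define e where "e = from_nat_into B"
  have e: "basis_of (range1 P) UNIV e"
  proof -
    have "e ` UNIV = B" "inj e"
      using e by (auto simp: e_def bij_betw_def)
    then show ?thesis
      using B orthonormal_image_iff[of e UNIV "\<lambda>x. x"] by (auto simp: basis_of_def o_def)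
  qed
  note on = basis_of_orthonormal[OF e]
  have Pe: "P (e i) = e i" for i
    using basis_of_in[OF e, of i] by (simp add: range1_def)
  obtain s :: "nat \<Rightarrow> nat" where s: "inj s" "ecard (- range s) = m"
  proof (cases m)
    case (enat n)
    have "- range (\<lambda>k::nat. k + n) = {..<n}"
      by (auto simp: image_iff) (metis le_add_diff_inverse2 not_less)
    then show thesis
      using that[of "\<lambda>k. k + n"] enat by (simp add: ecard_def inj_def)
  next
    case infinity
    have "infinite (- range (\<lambda>k::nat. 2 * k))"
    proof
      assume "finite (- range (\<lambda>k::nat. 2 * k))"
      moreover have "range (\<lambda>k::nat. 2 * k + 1) \<subseteq> - range (\<lambda>k::nat. 2 * k)"
        by auto presburger
      moreover have "infinite (range (\<lambda>k::nat. 2 * k + 1))"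
        by (rule range_inj_infinite) (simp add: inj_def)
      ultimately show False
        using finite_subset by blast
    qed
    then show thesis
      using that[of "\<lambda>k. 2 * k"] infinity by (simp add: ecard_def inj_def)
  qed
  have onf: "orthonormal UNIV (\<lambda>i. e (s i))"
    using on s(1) by (auto simp: orthonormal_def inj_eq)
  define L where "L = expand UNIV e (\<lambda>i. e (s i))"
  have bL: "bounded_clinear L"
    unfolding L_def by (rule bounded_clinear_expand[OF on onf])
  have LM: "P (L x) = L x" for x
    using expand_in_closed_csubspace[OF on onf M, of x] Pe by (simp add: L_def range1_def)
  define W where "W = doubled J P L"
  have W: "W \<in> isom_diag J P"
    unfolding W_def
  proof (rule doubled_isom_diag[OF J P bL])
    fix x y assume "P x = x" "P y = y"
    then show "cinner (L x) (L y) = cinner x y"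
      unfolding L_def by (intro cinner_expand_basis[OF e M onf]) (simp add: range1_def)
  qed (simp add: LM)
  note bW = isomD(1)[OF J isom_diagD(1)[OF J P W]]
  have We: "W (e i) = e (s i)" for i
    using doubled_range1(1)[OF J P bL Pe] expand_apply[OF on UNIV_I] by (simp add: W_def L_def)
  have "basis_of (coker W \<inter> range1 P) (- range s) e"
    unfolding basis_of_def
  proof (intro conjI ballI impI)
    show "orthonormal (- range s) e"
      by (rule orthonormal_subset[OF on]) simp
    show "e ` (- range s) \<subseteq> coker W \<inter> range1 P"
    proof (intro image_subsetI IntI)
      fix j assume j: "j \<in> - range s"
      show "e j \<in> range1 P"
        by (simp add: range1_def Pe)
      have "cinner x (cadjoint W (e j)) = 0" for x
      proof -
        have "cinner (L u) (e j) = 0" for u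
          unfolding L_def cinner_expand_left[OF on onf]
          using j orthonormalD[OF on, of _ j] by (subst expand_eq_0) auto
        then have "cinner (W x) (e j) = 0"
          using cinner_range1_conj(2)[OF J P Pe LM] by (simp add: W_def doubled_def cinner_add_left)
        then show ?thesis
          by (simp add: cinner_cadjoint(1)[OF bW])
      qed
      then show "e j \<in> coker W"
        using cinner_self_eq_0 unfolding coker_def by blast
    qed
    fix x assume x: "x \<in> coker W \<inter> range1 P" "\<forall>i\<in>- range s. cinner (e i) x = 0"
    have "cinner (e (s i)) x = 0" for i
      using x cinner_cadjoint(1)[OF bW, of "e i" x] by (simp add: We coker_def)
    then have "cinner (e j) x = 0" for j
      using x by (cases "j \<in> range s") auto
    then show "x = 0"
      using x by (intro basis_of_eq_0[OF e]) auto
  qed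
  then have "neg_ind W = 2 * ecard (e ` (- range s))"
    by (intro neg_ind_diag[OF J P W] basis_of_image)
  also have "inj_on e (- range s)"
    using orthonormal_inj[OF on] inj_on_subset by blast
  then have "ecard (e ` (- range s)) = m"
    using s(2) by (simp add: ecard_image)
  finally show ?thesis
    using W by blast
qed

section \<open>Orbits\<close>

lemma isom_P_unitary_iff:
  "U \<in> isom_P_unitary J P \<longleftrightarrow> U \<in> isom_P J P \<and> (\<forall>y. U (cadjoint U y) = y)"
  by (auto simp: isom_P_unitary_def fun_eq_iff)

text \<open>
  If \<open>V = U W\<close> and \<open>X = U' W'\<close> have the same index and the diagonal unitary \<open>Y\<close> carries \<open>W\<close> to \<open>W'\<close>, then
  \<open>U' Y U\<^sup>*\<close> carries \<open>V\<close> to \<open>X\<close>.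
\<close>

lemma left_orbit_eq:
  assumes sep: "separable_space (euclidean :: 'a::complex_hilbert topology)"
    and J: "conjugation (J :: 'a \<Rightarrow> 'a)" and P: "basis_projection J P"
    and V: "V \<in> isom_P_ind J P m"
  shows "left_orbit (isom_P_unitary J P) V = isom_P_ind J P m"
proof (intro equalityI subsetI)
  have V': "V \<in> isom_P J P" "neg_ind V = 2 * m" "V \<in> isom J"
    using V by (auto simp: isom_P_ind_def isom_P_def)
  fix X assume "X \<in> left_orbit (isom_P_unitary J P) V"
  then obtain U where U: "U \<in> isom_P J P" "\<And>y. U (cadjoint U y) = y" "X = U \<circ> V"
    by (auto simp: left_orbit_def isom_P_unitary_iff)
  then show "X \<in> isom_P_ind J P m"
    using isom_P_comp[OF J P U(1) V'(1)] neg_ind_comp_unitary[OF J _ U(2) V'(3)] V'(2)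
    by (auto simp: isom_P_ind_def isom_P_def)
next
  have factor: "\<exists>U W. U \<in> isom_HS J \<and> W \<in> isom_diag J P \<and> X = U \<circ> W \<and> neg_ind W = 2 * m"
    if "X \<in> isom_P_ind J P m" for X
  proof -
    have X: "X \<in> isom_P J P" "neg_ind X = 2 * m"
      using that by (auto simp: isom_P_ind_def)
    then obtain U W where UW: "U \<in> isom_HS J" "W \<in> isom_diag J P" "X = U \<circ> W"
      using isom_P_factorization[OF J P] by blast
    moreover have "U \<in> isom J"
      using UW by (simp add: isom_HS_def)
    ultimately have "neg_ind W = 2 * m"
      using X(2) neg_ind_comp_unitary[OF J _ isom_HS_surj[OF J UW(1)] isom_diagD(1)[OF J P UW(2)]] by simp
    with UW show ?thesis by blast
  qed
  fix X assume X: "X \<in> isom_P_ind J P m"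
  obtain U W where UW: "U \<in> isom_HS J" "W \<in> isom_diag J P" "V = U \<circ> W" "neg_ind W = 2 * m"
    using factor[OF V] by blast
  obtain U' W' where UW': "U' \<in> isom_HS J" "W' \<in> isom_diag J P" "X = U' \<circ> W'" "neg_ind W' = 2 * m"
    using factor[OF X] by blast
  obtain Y where Y: "Y \<in> isom_diag J P" "\<And>y. Y (cadjoint Y y) = y" "Y \<circ> W = W'"
    using diag_intertwiner[OF sep J P UW(2) UW'(2)] UW(4) UW'(4) by auto
  let ?U = "U' \<circ> (Y \<circ> cadjoint U)"
  note adj = isom_HS_cadjoint[OF J UW(1)]
  have iU: "U \<in> isom J" "cadjoint U \<in> isom J" and iU': "U' \<in> isom J"
    using UW(1) UW'(1) adj by (auto simp: isom_HS_def)
  have P_U: "?U \<in> isom_P J P"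
    using adj UW'(1) Y(1) isom_HS_subset_isom_P[OF J P] isom_diag_subset_isom_P[OF J P]
    by (intro isom_P_comp[OF J P]) auto
  then have "?U \<in> isom J"
    by (simp add: isom_P_def)
  moreover have "\<exists>x. ?U x = y" for y
    by (rule exI[of _ "U (cadjoint Y (cadjoint U' y))"])
      (simp add: isomD(4)[OF J iU(1)] Y(2) isom_HS_surj[OF J UW'(1)])
  ultimately have "?U (cadjoint ?U y) = y" for y
    using isomD(4)[OF J] by metis
  with P_U have "?U \<in> isom_P_unitary J P"
    by (simp add: isom_P_unitary_iff)
  moreover have "X = ?U \<circ> V"
    using Y(3) by (auto simp: UW(3) UW'(3) fun_eq_iff isomD(4)[OF J iU(1)])
  ultimately show "X \<in> left_orbit (isom_P_unitary J P) V"
    unfolding left_orbit_def by blast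
qed

lemma isom_P_has_index:
  assumes J: "conjugation J" and P: "basis_projection J P" and V: "V \<in> isom_P J P"
  shows "\<exists>m. V \<in> isom_P_ind J P m"
proof -
  obtain U W where UW: "U \<in> isom_HS J" "W \<in> isom_diag J P" "V = U \<circ> W"
    using V isom_P_factorization[OF J P] by blast
  then have "U \<in> isom J"
    by (simp add: isom_HS_def)
  then have "neg_ind V = neg_ind W"
    using UW(3) neg_ind_comp_unitary[OF J _ isom_HS_surj[OF J UW(1)] isom_diagD(1)[OF J P UW(2)]] by simp
  moreover obtain B where "basis_of (coker W \<inter> range1 P) B (\<lambda>x. x)"
    using coker_diag_basis_exists[OF J P UW(2)] .
  ultimately show ?thesis
    using neg_ind_diag[OF J P UW(2)] V by (auto simp: isom_P_ind_def)
qed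

theorem corollary2p13:
  fixes J P1 :: "'a::complex_hilbert \<Rightarrow> 'a"
  assumes "separable_space (euclidean :: 'a topology)"
    and "cdimension (UNIV :: 'a set) = \<infinity>"
    and "conjugation J"
    and "basis_projection J P1"
  shows "isom_P J P1 = {U \<circ> W | U W. U \<in> isom_HS J \<and> W \<in> isom_diag J P1} \<and>
         {left_orbit (isom_P_unitary J P1) V | V. V \<in> isom_P J P1}
           = {isom_P_ind J P1 m | m :: enat. True}"
proof (intro conjI isom_P_factorization[OF assms(3,4)] equalityI subsetI)
  fix S assume "S \<in> {left_orbit (isom_P_unitary J P1) V | V. V \<in> isom_P J P1}"
  then show "S \<in> {isom_P_ind J P1 m | m :: enat. True}"
    using isom_P_has_index[OF assms(3,4)] left_orbit_eq[OF assms(1,3,4)] by blast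
next
  fix S assume "S \<in> {isom_P_ind J P1 m | m :: enat. True}"
  then obtain m where m: "S = isom_P_ind J P1 m"
    by blast
  obtain W where "W \<in> isom_diag J P1" "neg_ind W = 2 * m"
    using diag_isometry_exists[OF assms] by blast
  then have "W \<in> isom_P_ind J P1 m"
    using isom_diag_subset_isom_P[OF assms(3,4)] by (auto simp: isom_P_ind_def)
  then show "S \<in> {left_orbit (isom_P_unitary J P1) V | V. V \<in> isom_P J P1}"
    using left_orbit_eq[OF assms(1,3,4)] m by (auto simp: isom_P_ind_def)
qed

end
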